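(* Let $|\Psi_{AB}\rangle=\sum_{i=0}^{d-1}\sqrt{\lambda_i}\,|\alpha_i\rangle\otimes|\beta_i\rangle\in\mathcal H^{d_A}\otimes\mathcal H^{d_B}$, $d=\min\{d_A,d_B\}$, be a pure entangled state in Schmidt form with $\lambda_0\ge\lambda_1\ge\dots\ge\lambda_{d-1}$, $\sum_i|\lambda_i|=1$ (so $\lambda_1>0$). For an angle $\theta$, a detector efficiency $\epsilon$ and $x\in\{0,1\}$ let $$|e_x^\theta\rangle=\cos\tfrac{\theta}{2}\,|\alpha_0\rangle+(-1)^x\sin\tfrac{\theta}{2}\,|\alpha_1\rangle,\qquad E_{+|x}=\epsilon\,|e^\theta_x\rangle\langle e^\theta_x|,\qquad E_{\emptyset|x}=I_A-E_{+|x},$$ and let $\sigma_{a|x}=\mathrm{Tr}_A[(E_{a|x}\otimes I_B)|\Psi_{AB}\rangle\langle\Psi_{AB}|]$ for $a\in\{+,\emptyset\}$. Put $\hat V=|\beta_0\rangle\langle\beta_1|+|\beta_1\rangle\langle\beta_0|$, $\tilde\sigma_z=|\beta_0\rangle\langle\beta_0|-|\beta_1\rangle\langle\beta_1|$, $K_+=\lambda_0-\mathrm{Tr}[\sigma_{+|x}]\ge0$, and $$\gamma=2\tan^{-1}\left(\frac{\sum_{x}\mathrm{Tr}[\hat V(\sigma_{+|0}-\sigma_{+|1})]}{K_+}\right).$$ Define $$F^\star_{+|0}=\tfrac18\Big[(1-\cos\tfrac\gamma2)|\beta_0\rangle\langle\beta_0|+\sin\tfrac\gamma2\,\hat V+(1+\cos\tfrac\gamma2)|\beta_1\rangle\langle\beta_1|\Big],$$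 $$F^\star_{+|1}=\tfrac18\Big[(\cos\tfrac\gamma2-1)|\beta_0\rangle\langle\beta_0|-\sin\tfrac\gamma2\,\hat V+(1+\cos\tfrac\gamma2)|\beta_1\rangle\langle\beta_1|\Big],$$ $$F^\star_{\emptyset|0}=\tfrac14(1-\cos\tfrac\gamma2)|\beta_0\rangle\langle\beta_0|,\qquad F^\star_{\emptyset|1}=0.$$ Then $\{F^\star_{a|x}\}$ is an optimal steering witness for the assemblage $\{\sigma_{a|x}\}$: it is feasible for the dual program (D) below, it attains the value $$\sum_{a,x}\mathrm{Tr}[F^\star_{a|x}\sigma_{a|x}]=\frac14\Big(\lambda_0-\mathrm{Tr}[\tilde\sigma_z\sigma_{+|x}]-\sqrt{\mathrm{Tr}[\hat V(\sigma_{+|0}-\sigma_{+|1})]^2+K_+^2}\Big),$$ and this value equals the optimal value $\mu^\star$ of the primal program (P) below, so that there is zero duality gap and $\{F^\star_{a|x}\}$ is an optimal solution of (D). Moreover, this family of witnesses asymptotically approaches the efficiency bound $\epsilon>\tfrac12$ as the overlap $|\langle e_0^\theta|e_1^\theta\rangle|^2\to1$, allowing violation (a negative value) for any pure entangled state with $\epsilon>\tfrac12$.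
   Context: $\mathcal H^{d}$ denotes a complex Hilbert space of finite dimension $d$; $\{|\alpha_i\rangle\}$ and $\{|\beta_i\rangle\}$ are orthonormal sets in $\mathcal H^{d_A}$ and $\mathcal H^{d_B}$. The traces $\mathrm{Tr}[\sigma_{+|x}]$ and $\mathrm{Tr}[\tilde\sigma_z\sigma_{+|x}]$ do not depend on $x\in\{0,1\}$. For the four deterministic strategies $\lambda:\{0,1\}\to\{+,\emptyset\}$ let $D(a|x,\lambda)=1$ if $a=\lambda(x)$ and $0$ otherwise. An assemblage $\{\sigma_{a|x}\}$ admits a local-hidden-state (LHS) model if $\sigma_{a|x}=\sum_\lambda D(a|x,\lambda)\sigma_\lambda$ for all $a,x$ with all $\sigma_\lambda\ge0$ (positive semidefinite). (P): maximize the real number $\mu$ over $\mu$ and operators $\{\sigma_\lambda\}_\lambda$ on $\mathcal H^{d_B}$ subject to $\sum_\lambda D(a|x,\lambda)\sigma_\lambda=\sigma_{a|x}$ for all $a,x$ and $\sigma_\lambda\ge\mu I_B$ for all $\lambda$. A non-negative optimum means that an LHS model exists. (D): minimize $\sum_{a,x}\mathrm{Tr}[F_{a|x}\sigma_{a|x}]$ over Hermitian operators $\{F_{a|x}\}$ on $\mathcal H^{d_B}$ subject to $\sum_{a,x}D(a|x,\lambda)F_{a|x}\ge0$ for all $\lambda$ and $\sum_{a,x,\lambda}\mathrm{Tr}[D(a|x,\lambda)F_{a|x}]=1$. A feasible $\{F_{a|x}\}$ is a steering witness: $\sum_{a,x}\mathrm{Tr}[F_{a|x}\sigma_{a|x}]\ge0$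 for every assemblage with an LHS model, so a negative value certifies that no LHS model exists (steering).
   Formalization: Sign and factor corrected: γ=2arctan(−(Tr[V̂(σ₊|₀−σ₊|₁)]/2)/K₊), with the limiting angle at K₊=0, and Tr[…]/2 under the root; optimality (value=μ* ) is claimed only if ε=0, sin(θ/2)=0 or ε cos²(θ/2)≥1/2; overlap→1 is taken from below with cos θ>0. *)

theory Defs
  imports "HOL-Analysis.Analysis"
begin

section \<open>Finite-dimensional operators\<close>

text \<open>
  A complex Hilbert space of dimension \<open>CARD('n)\<close> is \<open>complex ^ 'n\<close>, an operator on it is a square
  matrix. The library's \<open>inner\<close> on \<open>complex ^ 'n\<close> is only the real part of the Hermitian product,
  hence \<open>cip\<close> (conjugate-linear in the first argument).
\<close>

definition cip :: "complex ^ 'n \<Rightarrow> complex ^ 'n \<Rightarrow> complex" where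
  "cip u v = (\<Sum>i\<in>UNIV. cnj (u $ i) * v $ i)"

definition ketbra :: "complex ^ 'm \<Rightarrow> complex ^ 'n \<Rightarrow> complex ^ 'n ^ 'm" where
  "ketbra u v = (\<chi> i j. u $ i * cnj (v $ j))"

definition hermitian :: "complex ^ 'n ^ 'n \<Rightarrow> bool" where
  "hermitian A \<longleftrightarrow> (\<forall>i j. A $ i $ j = cnj (A $ j $ i))"

definition psd :: "complex ^ 'n ^ 'n \<Rightarrow> bool" where
  "psd A \<longleftrightarrow> hermitian A \<and> (\<forall>v. 0 \<le> Re (cip v (A *v v)))"

definition orthonormal_upto :: "nat \<Rightarrow> (nat \<Rightarrow> complex ^ 'n) \<Rightarrow> bool" where
  "orthonormal_upto d v \<longleftrightarrow> (\<forall>i<d. \<forall>j<d. cip (v i) (v j) = (if i = j then 1 else 0))"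

text \<open>Used only for Hermitian operators and products of two of them, whose traces are real.\<close>

definition rtr :: "complex ^ 'n ^ 'n \<Rightarrow> real" where
  "rtr A = Re (trace A)"

definition tensor_vec :: "complex ^ 'a \<Rightarrow> complex ^ 'b \<Rightarrow> complex ^ ('a::finite \<times> 'b::finite)" where
  "tensor_vec u v = (\<chi> p. u $ fst p * v $ snd p)"

definition tensor_op ::
  "complex ^ 'a ^ 'a \<Rightarrow> complex ^ 'b ^ 'b \<Rightarrow> complex ^ ('a::finite \<times> 'b::finite) ^ ('a \<times> 'b)" where
  "tensor_op A B = (\<chi> p q. A $ fst p $ fst q * B $ snd p $ snd q)"

definition ptrace_A :: "complex ^ ('a::finite \<times> 'b::finite) ^ ('a \<times> 'b) \<Rightarrow> complex ^ 'b ^ 'b" where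
  "ptrace_A M = (\<chi> i j. \<Sum>k\<in>UNIV. M $ (k, i) $ (k, j))"

definition entangled :: "complex ^ ('a::finite \<times> 'b::finite) \<Rightarrow> bool" where
  "entangled \<psi> \<longleftrightarrow> \<not> (\<exists>u v. \<psi> = tensor_vec u v)"


section \<open>Assemblages, local-hidden-state models and the two semidefinite programs\<close>

datatype outcome = Plus | Null

instance outcome :: finite
proof
  have "(UNIV :: outcome set) = {Plus, Null}"
    using outcome.exhaust by auto
  moreover have "finite {Plus, Null}"
    by simp
  ultimately show "finite (UNIV :: outcome set)"
    by metis
qed

text \<open>The measurement setting \<open>x = 0\<close> is \<open>False\<close> and \<open>x = 1\<close> is \<open>True\<close>.\<close>

type_synonym setting = bool
type_synonym strategy = "setting \<Rightarrow> outcome"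
type_synonym 'b assemblage = "outcome \<Rightarrow> setting \<Rightarrow> complex ^ 'b ^ 'b"

definition D :: "outcome \<Rightarrow> setting \<Rightarrow> strategy \<Rightarrow> real" where
  "D a x l = (if a = l x then 1 else 0)"

definition has_LHS :: "('b::finite) assemblage \<Rightarrow> bool" where
  "has_LHS \<sigma> \<longleftrightarrow> (\<exists>S :: strategy \<Rightarrow> complex ^ 'b ^ 'b.
     (\<forall>l. psd (S l)) \<and> (\<forall>a x. \<sigma> a x = (\<Sum>l\<in>UNIV. D a x l *\<^sub>R S l)))"

definition primal_feasible ::
  "('b::finite) assemblage \<Rightarrow> real \<Rightarrow> (strategy \<Rightarrow> complex ^ 'b ^ 'b) \<Rightarrow> bool" where
  "primal_feasible \<sigma> \<mu> S \<longleftrightarrow>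
     (\<forall>a x. (\<Sum>l\<in>UNIV. D a x l *\<^sub>R S l) = \<sigma> a x) \<and> (\<forall>l. psd (S l - \<mu> *\<^sub>R mat 1))"

definition primal_optimum :: "('b::finite) assemblage \<Rightarrow> real \<Rightarrow> bool" where
  "primal_optimum \<sigma> \<mu> \<longleftrightarrow>
     (\<exists>S. primal_feasible \<sigma> \<mu> S) \<and> (\<forall>\<mu>' S. primal_feasible \<sigma> \<mu>' S \<longrightarrow> \<mu>' \<le> \<mu>)"

definition witness_value :: "('b::finite) assemblage \<Rightarrow> ('b::finite) assemblage \<Rightarrow> real" where
  "witness_value F \<sigma> = (\<Sum>a\<in>UNIV. \<Sum>x\<in>UNIV. rtr (F a x ** \<sigma> a x))"

definition dual_feasible :: "('b::finite) assemblage \<Rightarrow> bool" where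
  "dual_feasible F \<longleftrightarrow>
     (\<forall>a x. hermitian (F a x)) \<and>
     (\<forall>l. psd (\<Sum>a\<in>UNIV. \<Sum>x\<in>UNIV. D a x l *\<^sub>R F a x)) \<and>
     (\<Sum>a\<in>UNIV. \<Sum>x\<in>UNIV. \<Sum>l\<in>UNIV. trace (D a x l *\<^sub>R F a x)) = 1"

definition dual_optimal :: "('b::finite) assemblage \<Rightarrow> ('b::finite) assemblage \<Rightarrow> bool" where
  "dual_optimal \<sigma> F \<longleftrightarrow>
     dual_feasible F \<and> (\<forall>G. dual_feasible G \<longrightarrow> witness_value F \<sigma> \<le> witness_value G \<sigma>)"

definition steering_witness :: "('b::finite) assemblage \<Rightarrow> bool" where
  "steering_witness F \<longleftrightarrow> (\<forall>\<tau>. has_LHS \<tau> \<longrightarrow> 0 \<le> witness_value F \<tau>)"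


section \<open>The state, the measurements and the resulting assemblage\<close>

definition schmidt_state ::
  "nat \<Rightarrow> (nat \<Rightarrow> complex ^ 'a) \<Rightarrow> (nat \<Rightarrow> complex ^ 'b) \<Rightarrow> (nat \<Rightarrow> real) \<Rightarrow> complex ^ ('a::finite \<times> 'b::finite)"
  where
  "schmidt_state d \<alpha> \<beta> lam = (\<Sum>i<d. sqrt (lam i) *\<^sub>R tensor_vec (\<alpha> i) (\<beta> i))"

definition e_vec :: "(nat \<Rightarrow> complex ^ 'a) \<Rightarrow> real \<Rightarrow> setting \<Rightarrow> complex ^ 'a" where
  "e_vec \<alpha> \<theta> x = cos (\<theta> / 2) *\<^sub>R \<alpha> 0 + ((if x then - 1 else 1) * sin (\<theta> / 2)) *\<^sub>R \<alpha> 1"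

fun effect ::
  "(nat \<Rightarrow> complex ^ 'a) \<Rightarrow> real \<Rightarrow> real \<Rightarrow> outcome \<Rightarrow> setting \<Rightarrow> complex ^ 'a ^ 'a" where
  "effect \<alpha> \<epsilon> \<theta> Plus x = \<epsilon> *\<^sub>R ketbra (e_vec \<alpha> \<theta> x) (e_vec \<alpha> \<theta> x)"
| "effect \<alpha> \<epsilon> \<theta> Null x = mat 1 - \<epsilon> *\<^sub>R ketbra (e_vec \<alpha> \<theta> x) (e_vec \<alpha> \<theta> x)"

definition assemblage_of ::
  "(nat \<Rightarrow> complex ^ 'a) \<Rightarrow> complex ^ ('a::finite \<times> 'b::finite) \<Rightarrow> real \<Rightarrow> real \<Rightarrow> ('b::finite) assemblage" where
  "assemblage_of \<alpha> \<psi> \<epsilon> \<theta> a x =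
     ptrace_A (tensor_op (effect \<alpha> \<epsilon> \<theta> a x) (mat 1) ** ketbra \<psi> \<psi>)"

definition overlap :: "(nat \<Rightarrow> complex ^ 'a) \<Rightarrow> real \<Rightarrow> real" where
  "overlap \<alpha> \<theta> = (cmod (cip (e_vec \<alpha> \<theta> False) (e_vec \<alpha> \<theta> True)))\<^sup>2"


section \<open>The witness\<close>

definition V_hat :: "(nat \<Rightarrow> complex ^ 'b) \<Rightarrow> complex ^ 'b ^ 'b" where
  "V_hat \<beta> = ketbra (\<beta> 0) (\<beta> 1) + ketbra (\<beta> 1) (\<beta> 0)"

definition sigma_z :: "(nat \<Rightarrow> complex ^ 'b) \<Rightarrow> complex ^ 'b ^ 'b" where
  "sigma_z \<beta> = ketbra (\<beta> 0) (\<beta> 0) - ketbra (\<beta> 1) (\<beta> 1)"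

definition K_plus :: "real \<Rightarrow> ('b::finite) assemblage \<Rightarrow> setting \<Rightarrow> real" where
  "K_plus lam0 \<sigma> x = lam0 - rtr (\<sigma> Plus x)"

text \<open>
  The off-diagonal term, averaged over the two settings: \<open>Tr[V (\<sigma>\<^bsub>+|0\<^esub> - \<sigma>\<^bsub>+|1\<^esub>)] / 2\<close>. With this
  normalization the value of the witness below is
  \<open>(\<lambda>\<^sub>0 - Tr[\<sigma>\<^sub>z \<sigma>\<^bsub>+|x\<^esub>] + sin (\<gamma>/2) off_diag - cos (\<gamma>/2) K\<^sub>+) / 4\<close>
  for every \<open>\<gamma>\<close>.
\<close>

definition off_diag :: "(nat \<Rightarrow> complex ^ 'b) \<Rightarrow> ('b::finite) assemblage \<Rightarrow> real" where
  "off_diag \<beta> \<sigma> = rtr (V_hat \<beta> ** (\<sigma> Plus False - \<sigma> Plus True)) / 2"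

text \<open>
  \<open>K\<^sub>+\<close> does not depend on the setting; setting 0 is used. The minimizing angle is \<open>\<gamma> = 2 arctan (- off_diag / K\<^sub>+)\<close>. For \<open>K\<^sub>+ = 0\<close> (which needs efficiency 1)
  the arctangent of the infinite quotient is its limit \<open>\<plusminus>\<pi>/2\<close>; the library's
  \<open>x / 0 = 0\<close> would give a wrong angle.
\<close>

definition gamma_angle :: "(nat \<Rightarrow> complex ^ 'b) \<Rightarrow> real \<Rightarrow> ('b::finite) assemblage \<Rightarrow> real" where
  "gamma_angle \<beta> lam0 \<sigma> =
     (if K_plus lam0 \<sigma> False = 0 then sgn (- off_diag \<beta> \<sigma>) * pi
      else 2 * arctan (- off_diag \<beta> \<sigma> / K_plus lam0 \<sigma> False))"

fun F_angle :: "(nat \<Rightarrow> complex ^ 'b) \<Rightarrow> real \<Rightarrow> ('b::finite) assemblage" where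
  "F_angle \<beta> \<gamma> Plus False = (1 / 8) *\<^sub>R
     ((1 - cos (\<gamma> / 2)) *\<^sub>R ketbra (\<beta> 0) (\<beta> 0) + sin (\<gamma> / 2) *\<^sub>R V_hat \<beta>
      + (1 + cos (\<gamma> / 2)) *\<^sub>R ketbra (\<beta> 1) (\<beta> 1))"
| "F_angle \<beta> \<gamma> Plus True = (1 / 8) *\<^sub>R
     ((cos (\<gamma> / 2) - 1) *\<^sub>R ketbra (\<beta> 0) (\<beta> 0) - sin (\<gamma> / 2) *\<^sub>R V_hat \<beta>
      + (1 + cos (\<gamma> / 2)) *\<^sub>R ketbra (\<beta> 1) (\<beta> 1))"
| "F_angle \<beta> \<gamma> Null False = (1 / 4) *\<^sub>R ((1 - cos (\<gamma> / 2)) *\<^sub>R ketbra (\<beta> 0) (\<beta> 0))"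
| "F_angle \<beta> \<gamma> Null True = 0"

definition F_star :: "(nat \<Rightarrow> complex ^ 'b) \<Rightarrow> real \<Rightarrow> ('b::finite) assemblage \<Rightarrow> ('b::finite) assemblage" where
  "F_star \<beta> lam0 \<sigma> = F_angle \<beta> (gamma_angle \<beta> lam0 \<sigma>)"

definition star_value ::
  "(nat \<Rightarrow> complex ^ 'a) \<Rightarrow> (nat \<Rightarrow> complex ^ 'b) \<Rightarrow> real \<Rightarrow> complex ^ ('a::finite \<times> 'b::finite) \<Rightarrow> real \<Rightarrow> real \<Rightarrow> real"
  where
  "star_value \<alpha> \<beta> lam0 \<psi> \<epsilon> \<theta> =
     (let \<sigma> = assemblage_of \<alpha> \<psi> \<epsilon> \<theta> in witness_value (F_star \<beta> lam0 \<sigma>) \<sigma>)"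

text \<open>The efficiency above which the witness at measurement angle \<open>\<theta>\<close> detects steering.\<close>

definition critical_efficiency ::
  "(nat \<Rightarrow> complex ^ 'a) \<Rightarrow> (nat \<Rightarrow> complex ^ 'b) \<Rightarrow> real \<Rightarrow> complex ^ ('a::finite \<times> 'b::finite) \<Rightarrow> real \<Rightarrow> real" where
  "critical_efficiency \<alpha> \<beta> lam0 \<psi> \<theta> = Inf {\<epsilon> \<in> {0..1}. star_value \<alpha> \<beta> lam0 \<psi> \<epsilon> \<theta> < 0}"

text \<open>
  The limit \<open>overlap \<rightarrow> 1\<close> (from below: at overlap 1 the two measurements coincide). The overlap is
  \<open>cos\<^sup>2 \<theta>\<close>, so it also tends to 1 when both measured vectors approach \<open>\<plusminus>\<alpha>\<^sub>1\<close>; the condition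
  \<open>cos \<theta> > 0\<close> selects the branch on which they approach \<open>\<plusminus>\<alpha>\<^sub>0\<close>. On the other branch
  \<open>cos\<^sup>2 (\<theta>/2)\<close> tends to 0 and the value is not negative.
\<close>

definition overlap_to_one :: "(nat \<Rightarrow> complex ^ 'a) \<Rightarrow> real filter" where
  "overlap_to_one \<alpha> = inf (filtercomap (overlap \<alpha>) (at_left 1)) (principal {\<theta>. cos \<theta> > 0})"

end

theory Submission
  imports Defs
begin

text \<open>
  All operators involved are real combinations of \<open>|\<beta>\<^sub>0\<rangle>\<langle>\<beta>\<^sub>0|\<close>, \<open>V\<close>, \<open>|\<beta>\<^sub>1\<rangle>\<langle>\<beta>\<^sub>1|\<close> and a part on the
  orthogonal complement. Write \<open>\<sigma>\<^bsub>+|x\<^esub>\<close> as the real symmetric matrix with diagonal \<open>(a, e)\<close> and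
  off-diagonal entry \<open>\<plusminus>b\<close>, so that \<open>a e = b\<^sup>2\<close>. Up to scaling, the operators
  \<open>\<Sum>\<^bsub>a,x\<^esub> D(a|x,\<lambda>) F\<^bsub>a|x\<^esub>\<close> are projectors, and complementary slackness dictates the optimal
  hidden states: \<open>\<sigma>\<^bsub>++\<^esub>\<close> is diagonal with entries \<open>\<mu> + 2a - \<lambda>\<^sub>0\<close> and \<open>\<mu>\<close>, and the remaining matrix
  \<open>\<sigma>\<^bsub>+|x\<^esub> - \<sigma>\<^bsub>++\<^esub> - \<mu>\<close> is singular, which is the quadratic equation solved by the value of the
  witness. Unless \<open>b = 0\<close>, all hidden states dominate \<open>\<mu>\<close> exactly when \<open>2a \<ge> \<lambda>\<^sub>0\<close>, that is
  \<open>\<epsilon> cos\<^sup>2(\<theta>/2) \<ge> 1/2\<close>. The sign of the same quadratic gives violation iff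
  \<open>\<epsilon> cos\<^sup>2(\<theta>/2) > 1/2\<close> and \<open>sin(\<theta>/2) \<noteq> 0\<close>, and \<open>cos\<^sup>2(\<theta>/2) = (1 + cos \<theta>)/2\<close> with
  \<open>cos\<^sup>2 \<theta>\<close> the overlap.
\<close>

section \<open>Sesquilinear algebra\<close>

lemma cip_add_left: "cip (u + v) w = cip u w + cip v w"
  by (simp add: cip_def algebra_simps sum.distrib)

lemma cip_diff_right: "cip u (v - w) = cip u v - cip u w"
  by (simp add: cip_def algebra_simps sum_subtractf)

lemma cip_scaleR_left: "cip (r *\<^sub>R u) v = r *\<^sub>R cip u v"
  by (simp add: cip_def scaleR_sum_right)

lemma cip_scaleR_right: "cip u (r *\<^sub>R v) = r *\<^sub>R cip u v"
  by (simp add: cip_def scaleR_sum_right)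

lemma cip_scale_right: "cip u (c *s v) = c * cip u v"
  by (simp add: cip_def sum_distrib_left algebra_simps)

lemma cnj_cip: "cnj (cip u v) = cip v u"
  by (simp add: cip_def mult.commute)

lemma trace_scaleR: "trace (r *\<^sub>R A) = r *\<^sub>R trace (A :: complex ^ 'n ^ 'n)"
  by (simp add: trace_def scaleR_sum_right)

lemma trace_sum: "trace (\<Sum>i\<in>I. A i) = (\<Sum>i\<in>I. trace (A i :: complex ^ 'n ^ 'n))"
  unfolding trace_def by (simp add: sum.swap[of _ I])

lemma trace_ketbra: "trace (ketbra u v) = cip v u"
  by (simp add: trace_def ketbra_def cip_def mult.commute)

lemma trace_mult_ketbra: "trace (A ** ketbra u v) = cip v (A *v u)"
  by (simp add: trace_def ketbra_def cip_def matrix_matrix_mult_def matrix_vector_mult_def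
      sum_distrib_left algebra_simps)

lemma ketbra_mult_vec: "ketbra u v *v w = cip v w *s u"
  by (simp add: vec_eq_iff ketbra_def cip_def matrix_vector_mult_def
      sum_distrib_left sum_distrib_right algebra_simps)

lemma ketbra_mult_ketbra: "ketbra u v ** ketbra w z = ketbra (cip v w *s u) z"
  by (simp add: vec_eq_iff ketbra_def cip_def matrix_matrix_mult_def
      sum_distrib_left sum_distrib_right algebra_simps)

lemma rtr_add: "rtr (A + B) = rtr A + rtr B"
  by (simp add: rtr_def trace_add)

lemma rtr_diff: "rtr (A - B) = rtr A - rtr B"
  by (simp add: rtr_def trace_sub)

lemma rtr_scaleR: "rtr (r *\<^sub>R A) = r * rtr A"
  by (simp add: rtr_def trace_scaleR)

lemma rtr_sum: "rtr (\<Sum>i\<in>I. A i) = (\<Sum>i\<in>I. rtr (A i))"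
  by (simp add: rtr_def trace_sum)

lemma rtr_mult_commute: "rtr (A ** B) = rtr (B ** A)"
  by (metis rtr_def trace_mul_sym)

lemma mult_scaleR_matrix:
  fixes A B :: "complex ^ 'n ^ 'n"
  shows "(r *\<^sub>R A) ** B = r *\<^sub>R (A ** B)" "A ** (r *\<^sub>R B) = r *\<^sub>R (A ** B)"
  by (simp_all add: vec_eq_iff matrix_matrix_mult_def scaleR_sum_right)

lemma matrix_add_rdistrib: "(A + B) ** C = A ** C + B ** C"
  by (simp add: vec_eq_iff matrix_matrix_mult_def sum.distrib algebra_simps)

lemma mult_sum_matrix:
  fixes A :: "complex ^ 'n ^ 'n"
  shows "(\<Sum>i\<in>I. C i) ** A = (\<Sum>i\<in>I. C i ** A)" "A ** (\<Sum>i\<in>I. C i) = (\<Sum>i\<in>I. A ** C i)"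
proof -
  show "(\<Sum>i\<in>I. C i) ** A = (\<Sum>i\<in>I. C i ** A)"
    by (induction I rule: infinite_finite_induct) (simp_all add: matrix_add_rdistrib)
  show "A ** (\<Sum>i\<in>I. C i) = (\<Sum>i\<in>I. A ** C i)"
    by (induction I rule: infinite_finite_induct) (simp_all add: matrix_add_ldistrib)
qed

lemma mult_diff_matrix:
  fixes A B C :: "complex ^ 'n ^ 'n"
  shows "(A - B) ** C = A ** C - B ** C" "C ** (A - B) = C ** A - C ** B"
  by (simp_all add: vec_eq_iff matrix_matrix_mult_def sum_subtractf algebra_simps)

lemmas rtr_mult_linear = matrix_add_ldistrib matrix_add_rdistrib mult_diff_matrix
  mult_scaleR_matrix mult_sum_matrix rtr_add rtr_diff rtr_scaleR rtr_sum


section \<open>The dual of the positive semidefinite cone\<close>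

text \<open>
  The positive semidefinite cone is self-dual, but only the inclusion \<open>dual_cone_imp_psd\<close> is
  needed: all operators that occur are visibly sums of projectors, hence in the dual cone, and this
  makes the spectral theorem unnecessary.
\<close>

definition dual_cone :: "complex ^ 'n ^ 'n \<Rightarrow> bool" where
  "dual_cone A \<longleftrightarrow> hermitian A \<and> (\<forall>G. psd G \<longrightarrow> 0 \<le> rtr (G ** A))"

lemma hermitian_ketbra: "hermitian (ketbra u u)"
  by (simp add: hermitian_def ketbra_def)

lemma hermitian_nth: "hermitian A \<Longrightarrow> cnj (A $ j $ i) = A $ i $ j"
  by (metis hermitian_def)

lemma hermitian_add: "hermitian A \<Longrightarrow> hermitian B \<Longrightarrow> hermitian (A + B)"
  by (subst hermitian_def) (simp add: hermitian_nth)

lemma hermitian_diff: "hermitian A \<Longrightarrow> hermitian B \<Longrightarrow> hermitian (A - B)"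
  by (subst hermitian_def) (simp add: hermitian_nth)

lemma hermitian_scaleR: "hermitian A \<Longrightarrow> hermitian (r *\<^sub>R A)"
  by (subst hermitian_def) (simp add: hermitian_nth)

lemma hermitian_mat_1: "hermitian (mat 1)"
  by (simp add: hermitian_def mat_def)

lemma psd_ketbra: "psd (ketbra u u)"
proof -
  have "0 \<le> Re (cip v (ketbra u u *v v))" for v
  proof -
    have "cip v (ketbra u u *v v) = cip u v * cip v u"
      by (simp add: ketbra_mult_vec cip_scale_right)
    also have "\<dots> = of_real ((cmod (cip u v))\<^sup>2)"
      by (metis cnj_cip complex_norm_square of_real_power)
    finally show ?thesis
      by (metis Re_complex_of_real zero_le_power2)
  qed
  then show ?thesis
    by (simp add: psd_def hermitian_ketbra)
qed

text \<open>Pairing with the rank-one operator \<open>ketbra v v\<close> recovers the quadratic form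
  of \<open>A\<close> at \<open>v\<close>.\<close>

lemma dual_cone_imp_psd:
  assumes "dual_cone A"
  shows "psd A"
proof -
  have "0 \<le> Re (cip v (A *v v))" for v
  proof -
    have "0 \<le> rtr (ketbra v v ** A)"
      using assms psd_ketbra[of v] by (auto simp: dual_cone_def)
    also have "\<dots> = Re (cip v (A *v v))"
      by (subst rtr_mult_commute) (simp add: rtr_def trace_mult_ketbra)
    finally show ?thesis .
  qed
  with assms show ?thesis
    by (simp add: psd_def dual_cone_def)
qed

lemma dual_cone_add: "dual_cone A \<Longrightarrow> dual_cone B \<Longrightarrow> dual_cone (A + B)"
  by (simp add: dual_cone_def hermitian_add matrix_add_ldistrib rtr_add)

lemma dual_cone_scaleR: "0 \<le> r \<Longrightarrow> dual_cone A \<Longrightarrow> dual_cone (r *\<^sub>R A)"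
  by (simp add: dual_cone_def hermitian_scaleR mult_scaleR_matrix rtr_scaleR)

lemma dual_cone_sum: "(\<And>i. i \<in> I \<Longrightarrow> dual_cone (A i)) \<Longrightarrow> dual_cone (\<Sum>i\<in>I. A i)"
proof (induction I rule: infinite_finite_induct)
  case (insert i I)
  then show ?case
    by (simp add: dual_cone_add)
qed (simp_all add: dual_cone_def hermitian_def rtr_def trace_def)

lemma dual_cone_ketbra: "dual_cone (ketbra u u)"
  by (simp add: dual_cone_def hermitian_ketbra rtr_def trace_mult_ketbra psd_def)

text \<open>Here \<open>P\<close> equals \<open>P\<close> times its adjoint, which is the sum of the
  rank-one operators on the columns of \<open>P\<close>.\<close>

lemma dual_cone_projector:
  assumes "hermitian P" "P ** P = P"
  shows "dual_cone P"
proof -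
  have "P = (\<Sum>k\<in>UNIV. ketbra (column k P) (column k P))" (is "P = ?R")
  proof -
    have "P $ i $ j = ?R $ i $ j" for i j
    proof -
      have "P $ i $ j = (P ** P) $ i $ j"
        using assms by simp
      also have "\<dots> = (\<Sum>k\<in>UNIV. P $ i $ k * P $ k $ j)"
        by (simp add: matrix_matrix_mult_def)
      also have "\<dots> = (\<Sum>k\<in>UNIV. P $ i $ k * cnj (P $ j $ k))"
        by (simp add: hermitian_nth[OF assms(1)])
      finally show ?thesis
        by (simp add: ketbra_def column_def)
    qed
    then show ?thesis
      by (simp add: vec_eq_iff)
  qed
  then show ?thesis
    by (metis (no_types, lifting) dual_cone_ketbra dual_cone_sum)
qed


section \<open>Weak duality\<close>

lemma UNIV_outcome: "(UNIV :: outcome set) = {Plus, Null}"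
  using outcome.exhaust by auto

lemma sum_outcome: "(\<Sum>a\<in>UNIV. f a) = f Plus + f Null"
  by (simp add: UNIV_outcome)

lemma sum_setting: "(\<Sum>x\<in>UNIV. f x) = f False + f True"
  by (simp add: UNIV_bool)

definition strat :: "outcome \<Rightarrow> outcome \<Rightarrow> strategy" where
  "strat a b x = (if x then b else a)"

lemma strat_eq: "l = strat (l False) (l True)"
  by (auto simp: strat_def fun_eq_iff)

lemma sum_strategy:
  "(\<Sum>l\<in>UNIV. f l) = f (strat Plus Plus) + f (strat Plus Null) + f (strat Null Plus) + f (strat Null Null)"
    (is "_ = ?r")
proof -
  have "bij_betw (\<lambda>(a, b). strat a b) UNIV UNIV"
    by (rule bij_betwI[where g = "\<lambda>l. (l False, l True)"]) (auto simp: strat_def fun_eq_iff)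
  then have "(\<Sum>l\<in>UNIV. f l) = (\<Sum>p\<in>UNIV. f (case p of (a, b) \<Rightarrow> strat a b))"
    by (simp add: sum.reindex_bij_betw)
  also have "\<dots> = (\<Sum>a\<in>UNIV. \<Sum>b\<in>UNIV. f (strat a b))"
    by (simp add: sum.cartesian_product flip: UNIV_Times_UNIV) (simp add: case_prod_beta)
  also have "\<dots> = ?r"
    by (simp add: sum_outcome add.assoc)
  finally show ?thesis .
qed

text \<open>The operator dual to the hidden state of strategy \<open>l\<close>: (D) asks these four
  operators to be positive with total trace 1.\<close>

definition strategy_op :: "('b::finite) assemblage \<Rightarrow> strategy \<Rightarrow> complex ^ 'b ^ 'b" where
  "strategy_op F l = (\<Sum>a\<in>UNIV. \<Sum>x\<in>UNIV. D a x l *\<^sub>R F a x)"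

lemma strategy_op_strat: "strategy_op F (strat a b) = F a False + F b True"
  by (cases a; cases b) (simp_all add: strategy_op_def sum_outcome sum_setting D_def strat_def)

lemma dual_feasible_iff:
  "dual_feasible F \<longleftrightarrow> (\<forall>a x. hermitian (F a x)) \<and> (\<forall>l. psd (strategy_op F l)) \<and>
     (\<Sum>l\<in>UNIV. trace (strategy_op F l)) = 1"
proof -
  have "(\<Sum>l\<in>UNIV. trace (strategy_op F l)) =
      (\<Sum>a\<in>UNIV. \<Sum>x\<in>UNIV. \<Sum>l\<in>UNIV. trace (D a x l *\<^sub>R F a x))"
    unfolding strategy_op_def trace_sum
    by (subst sum.swap) (intro sum.cong refl, rule sum.swap)
  then show ?thesis
    by (simp add: dual_feasible_def strategy_op_def)
qed

text \<open>Interchanging the sums moves the deterministic responses from the hidden states to the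
  witness. Weak duality and the bound for LHS models both rest on this pairing.\<close>

lemma witness_value_strategies:
  assumes "\<And>a x. \<sigma> a x = (\<Sum>l\<in>UNIV. D a x l *\<^sub>R S l)"
  shows "witness_value F \<sigma> = (\<Sum>l\<in>UNIV. rtr (strategy_op F l ** S l))"
proof -
  have "witness_value F \<sigma> = (\<Sum>a\<in>UNIV. \<Sum>x\<in>UNIV. \<Sum>l\<in>UNIV. D a x l * rtr (F a x ** S l))"
    by (simp add: witness_value_def assms rtr_mult_linear)
  also have "\<dots> = (\<Sum>l\<in>UNIV. \<Sum>a\<in>UNIV. \<Sum>x\<in>UNIV. D a x l * rtr (F a x ** S l))"
    by (subst sum.swap[of _ UNIV "UNIV :: strategy set"], intro sum.cong refl, rule sum.swap)
  finally show ?thesis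
    by (simp add: strategy_op_def rtr_mult_linear)
qed

text \<open>Positivity is assumed for traces so that it can be supplied from either side: by
  strategy operators in \<open>dual_cone\<close> against any primal point, or by hidden states in
  \<open>dual_cone\<close> against any dual point. The unit total trace turns the shift by \<mu>
  into the bound.\<close>

lemma weak_duality:
  assumes F: "dual_feasible F" and S: "\<And>a x. (\<Sum>l\<in>UNIV. D a x l *\<^sub>R S l) = \<sigma> a x"
    and pos: "\<And>l. 0 \<le> rtr (strategy_op F l ** (S l - \<mu> *\<^sub>R mat 1))"
  shows "\<mu> \<le> witness_value F \<sigma>"
proof -
  have "(\<Sum>l\<in>UNIV. rtr (strategy_op F l)) = Re (\<Sum>l\<in>UNIV. trace (strategy_op F l))"
    by (simp add: rtr_def)
  also have "\<dots> = 1"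
    using F by (simp add: dual_feasible_iff del: Re_sum)
  finally have "(\<Sum>l\<in>UNIV. rtr (strategy_op F l)) = 1" .
  moreover have "\<mu> * rtr (strategy_op F l) \<le> rtr (strategy_op F l ** S l)" for l
    using pos[of l] by (simp add: rtr_mult_linear)
  then have "(\<Sum>l\<in>UNIV. \<mu> * rtr (strategy_op F l)) \<le> (\<Sum>l\<in>UNIV. rtr (strategy_op F l ** S l))"
    by (intro sum_mono) auto
  ultimately show ?thesis
    using S by (simp add: witness_value_strategies[of \<sigma> S] flip: sum_distrib_left)
qed

lemma steering_witness_if_dual_cone:
  assumes "\<And>l. dual_cone (strategy_op F l)"
  shows "steering_witness F"
  unfolding steering_witness_def has_LHS_def
proof (intro allI impI, elim exE conjE)
  fix \<tau> :: "'a assemblage" and S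
  assume psd: "\<forall>l. psd (S l)" and S: "\<forall>a x. \<tau> a x = (\<Sum>l\<in>UNIV. D a x l *\<^sub>R S l)"
  have "0 \<le> (\<Sum>l\<in>UNIV. rtr (strategy_op F l ** S l))"
    using assms psd by (intro sum_nonneg) (simp add: dual_cone_def rtr_mult_commute[of _ "S _"])
  then show "0 \<le> witness_value F \<tau>"
    using S by (simp add: witness_value_strategies)
qed

text \<open>A certificate of optimality: both points have the same value and their operators lie in
  \<open>dual_cone\<close>, so each bounds all competitors of the other program, which are only
  known to be \<open>psd\<close>.\<close>

lemma strong_duality:
  assumes F: "dual_feasible F" and cone: "\<And>l. dual_cone (strategy_op F l)"
    and S: "\<And>a x. (\<Sum>l\<in>UNIV. D a x l *\<^sub>R S l) = \<sigma> a x"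
    and S_cone: "\<And>l. dual_cone (S l - witness_value F \<sigma> *\<^sub>R mat 1)"
  shows "primal_optimum \<sigma> (witness_value F \<sigma>) \<and> dual_optimal \<sigma> F"
proof
  have "primal_feasible \<sigma> (witness_value F \<sigma>) S"
    using S S_cone dual_cone_imp_psd by (auto simp: primal_feasible_def)
  moreover have "\<mu> \<le> witness_value F \<sigma>" if "primal_feasible \<sigma> \<mu> T" for \<mu> T
    using that cone
    by (intro weak_duality[OF F, of T])
      (auto simp: primal_feasible_def dual_cone_def rtr_mult_commute[of "strategy_op F _"])
  ultimately show "primal_optimum \<sigma> (witness_value F \<sigma>)"
    by (auto simp: primal_optimum_def)
  have "witness_value F \<sigma> \<le> witness_value G \<sigma>" if "dual_feasible G" for G
    using that S_cone by (intro weak_duality[OF that S]) (auto simp: dual_cone_def dual_feasible_iff)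
  then show "dual_optimal \<sigma> F"
    using F by (auto simp: dual_optimal_def)
qed


lemma rtr_ketbra_ketbra:
  "rtr (ketbra u v ** ketbra w z) = Re (cip v w * cip z u)"
  by (simp add: rtr_def ketbra_mult_ketbra trace_ketbra cip_scale_right)


section \<open>Operators on the span of the first two Schmidt vectors\<close>

text \<open>For orthonormal \<beta>, the real symmetric matrix with rows (a, b) and (b, e) in the
  basis \<open>\<beta> 0\<close>, \<open>\<beta> 1\<close>, extended by zero.\<close>

definition block :: "(nat \<Rightarrow> complex ^ 'n) \<Rightarrow> real \<Rightarrow> real \<Rightarrow> real \<Rightarrow> complex ^ 'n ^ 'n" where
  "block \<beta> a b e = a *\<^sub>R ketbra (\<beta> 0) (\<beta> 0) + b *\<^sub>R V_hat \<beta> + e *\<^sub>R ketbra (\<beta> 1) (\<beta> 1)"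

lemma block_add: "block \<beta> a b e + block \<beta> a' b' e' = block \<beta> (a + a') (b + b') (e + e')"
  by (simp add: block_def algebra_simps)

lemma block_diff: "block \<beta> a b e - block \<beta> a' b' e' = block \<beta> (a - a') (b - b') (e - e')"
  by (simp add: block_def algebra_simps)

lemma block_scaleR: "r *\<^sub>R block \<beta> a b e = block \<beta> (r * a) (r * b) (r * e)"
  by (simp add: block_def algebra_simps)

lemma V_hat_block: "V_hat \<beta> = block \<beta> 0 1 0"
  by (simp add: block_def)

lemma sigma_z_block: "sigma_z \<beta> = block \<beta> 1 0 (- 1)"
  by (simp add: block_def sigma_z_def)

lemma hermitian_block: "hermitian (block \<beta> a b e)"
proof -
  have "hermitian (V_hat \<beta>)"
    by (simp add: hermitian_def V_hat_def ketbra_def)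
  then show ?thesis
    unfolding block_def by (intro hermitian_add hermitian_scaleR hermitian_ketbra)
qed

lemma ketbra_combination:
  "ketbra (p *\<^sub>R \<beta> 0 + q *\<^sub>R \<beta> 1) (p *\<^sub>R \<beta> 0 + q *\<^sub>R \<beta> 1) = block \<beta> (p\<^sup>2) (p * q) (q\<^sup>2)"
  by (simp add: block_def V_hat_def vec_eq_iff ketbra_def algebra_simps power2_eq_square)

text \<open>A vanishing determinant makes the block rank one, so no spectral argument is
  involved.\<close>

lemma dual_cone_block:
  assumes "0 \<le> p" "0 \<le> q" "p * q = b\<^sup>2"
  shows "dual_cone (block \<beta> p b q)"
proof -
  \<comment> \<open>The second coordinate carries the sign of \<open>b\<close>.\<close>
  define t where "t = (if b < 0 then - sqrt q else sqrt q)"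
  have "sqrt p * sqrt q = \<bar>b\<bar>"
    using assms by (metis real_sqrt_abs real_sqrt_mult)
  then have "sqrt p * t = b" "t\<^sup>2 = q"
    using assms by (auto simp: t_def)
  then show ?thesis
    using ketbra_combination[of "sqrt p" \<beta> t] dual_cone_ketbra assms
    by (metis real_sqrt_pow2)
qed

lemma dual_cone_diagonal:
  assumes "0 \<le> p" "0 \<le> q"
  shows "dual_cone (block \<beta> p 0 q)"
  using dual_cone_add[OF dual_cone_block[of p 0 0 \<beta>] dual_cone_block[of 0 q 0 \<beta>]] assms
  by (simp add: block_add)

context
  fixes d :: nat and \<beta> :: "nat \<Rightarrow> complex ^ 'n"
  assumes orthonormal: "orthonormal_upto d \<beta>" and two_le: "2 \<le> d"
begin

lemma cip_orthonormal: "i < d \<Longrightarrow> j < d \<Longrightarrow> cip (\<beta> i) (\<beta> j) = (if i = j then 1 else 0)"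
  using orthonormal by (simp add: orthonormal_upto_def)

lemma cip_first: "cip (\<beta> 0) (\<beta> 0) = 1" "cip (\<beta> 0) (\<beta> (Suc 0)) = 0"
    "cip (\<beta> (Suc 0)) (\<beta> 0) = 0" "cip (\<beta> (Suc 0)) (\<beta> (Suc 0)) = 1"
  using two_le by (simp_all add: cip_orthonormal)

lemma trace_block: "trace (block \<beta> a b e) = of_real (a + e)"
  by (simp add: block_def V_hat_def trace_add trace_scaleR trace_ketbra cip_first)
    (simp add: scaleR_conv_of_real)

lemma rtr_block_block: "rtr (block \<beta> a b e ** block \<beta> a' b' e') = a * a' + 2 * b * b' + e * e'"
  by (simp add: block_def V_hat_def rtr_mult_linear rtr_ketbra_ketbra cip_first)

lemma rtr_block: "rtr (block \<beta> a b e) = a + e"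
  by (simp add: rtr_def trace_block)

text \<open>The constraints of (P) involve the identity of the whole space; this is the projector
  that completes a block to it.\<close>

lemma dual_cone_complement: "dual_cone (mat 1 - block \<beta> 1 0 1)"
proof (rule dual_cone_projector)
  show "hermitian (mat 1 - block \<beta> 1 0 1)"
    by (intro hermitian_diff hermitian_mat_1 hermitian_block)
  have ketbra_0: "ketbra (0 :: complex ^ 'n) v = 0" for v :: "complex ^ 'n"
    by (simp add: ketbra_def vec_eq_iff)
  have "block \<beta> 1 0 1 ** block \<beta> 1 0 1 = block \<beta> 1 0 1"
    by (simp add: block_def matrix_add_ldistrib matrix_add_rdistrib ketbra_mult_ketbra cip_first ketbra_0)
  then show "(mat 1 - block \<beta> 1 0 1) ** (mat 1 - block \<beta> 1 0 1) = mat 1 - block \<beta> 1 0 1"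
    by (simp add: mult_diff_matrix)
qed

end


section \<open>The assemblage\<close>

text \<open>The partial inner product of \<open>u\<close> with the first tensor factor of
  \<psi>.\<close>

definition contract :: "complex ^ 'a \<Rightarrow> complex ^ ('a::finite \<times> 'b::finite) \<Rightarrow> complex ^ 'b" where
  "contract u \<psi> = (\<chi> i. \<Sum>k\<in>UNIV. cnj (u $ k) * \<psi> $ (k, i))"

lemma contract_tensor_vec: "contract u (tensor_vec v w) = cip u v *s w"
  by (simp add: contract_def tensor_vec_def cip_def vec_eq_iff sum_distrib_left ac_simps)

lemma contract_add: "contract u (\<psi> + \<phi>) = contract u \<psi> + contract u \<phi>"
  by (simp add: contract_def vec_eq_iff algebra_simps sum.distrib)

lemma contract_scaleR: "contract u (r *\<^sub>R \<psi>) = r *\<^sub>R contract u \<psi>"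
  by (simp add: contract_def vec_eq_iff scaleR_sum_right)

lemma contract_sum: "contract u (\<Sum>i\<in>I. \<psi> i) = (\<Sum>i\<in>I. contract u (\<psi> i))"
proof (induction I rule: infinite_finite_induct)
  case (insert i I)
  then show ?case
    by (simp add: contract_add)
qed (simp_all add: contract_def vec_eq_iff)

lemma ptrace_tensor_nth:
  "ptrace_A (tensor_op A (mat 1) ** ketbra \<psi> \<psi>) $ i $ j =
    (\<Sum>k\<in>UNIV. \<Sum>l\<in>UNIV. A $ k $ l * \<psi> $ (l, i) * cnj (\<psi> $ (k, j)))"
proof -
  have "(\<Sum>p\<in>UNIV. A $ k $ fst p * (if i = snd p then 1 else 0) * (\<psi> $ p * cnj (\<psi> $ (k, j)))) =
      (\<Sum>l\<in>UNIV. A $ k $ l * \<psi> $ (l, i) * cnj (\<psi> $ (k, j)))" (is "?l k = ?r k") for k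
  proof -
    have "?l k = (\<Sum>l\<in>UNIV. \<Sum>m\<in>UNIV. A $ k $ l * (if i = m then 1 else 0) * (\<psi> $ (l, m) * cnj (\<psi> $ (k, j))))"
      by (simp add: sum.cartesian_product flip: UNIV_Times_UNIV) (simp add: case_prod_beta)
    also have "\<dots> = (\<Sum>l\<in>UNIV. \<Sum>m\<in>UNIV. if i = m then A $ k $ l * \<psi> $ (l, m) * cnj (\<psi> $ (k, j)) else 0)"
      by (intro sum.cong refl) simp
    finally show ?thesis
      by simp
  qed
  then show ?thesis
    by (simp add: ptrace_A_def tensor_op_def matrix_matrix_mult_def ketbra_def mat_def)
qed

text \<open>A rank-one effect on one side leaves a pure unnormalized state on the other, whence the
  zero determinant in \<open>coef_0_coef_1\<close>.\<close>

lemma ptrace_ketbra: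
  "ptrace_A (tensor_op (ketbra u u) (mat 1) ** ketbra \<psi> \<psi>) = ketbra (contract u \<psi>) (contract u \<psi>)"
proof -
  have "ptrace_A (tensor_op (ketbra u u) (mat 1) ** ketbra \<psi> \<psi>) $ i $ j =
      ketbra (contract u \<psi>) (contract u \<psi>) $ i $ j" for i j
  proof -
    have "ketbra (contract u \<psi>) (contract u \<psi>) $ i $ j =
        (\<Sum>l\<in>UNIV. \<Sum>k\<in>UNIV. cnj (u $ l) * \<psi> $ (l, i) * (u $ k * cnj (\<psi> $ (k, j))))"
      by (simp add: ketbra_def contract_def sum_product)
    also have "\<dots> = (\<Sum>k\<in>UNIV. \<Sum>l\<in>UNIV. ketbra u u $ k $ l * \<psi> $ (l, i) * cnj (\<psi> $ (k, j)))"
      by (subst sum.swap) (simp add: ketbra_def ac_simps)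
    finally show ?thesis
      by (simp add: ptrace_tensor_nth)
  qed
  then show ?thesis
    by (simp add: vec_eq_iff)
qed

lemma ptrace_scaleR:
  "ptrace_A (tensor_op (r *\<^sub>R A) (mat 1) ** ketbra \<psi> \<psi>) =
    r *\<^sub>R ptrace_A (tensor_op A (mat 1) ** ketbra \<psi> \<psi>)"
  by (simp add: vec_eq_iff ptrace_tensor_nth scaleR_sum_right)

lemma ptrace_diff:
  "ptrace_A (tensor_op (A - B) (mat 1) ** ketbra \<psi> \<psi>) =
    ptrace_A (tensor_op A (mat 1) ** ketbra \<psi> \<psi>) - ptrace_A (tensor_op B (mat 1) ** ketbra \<psi> \<psi>)"
  by (simp add: vec_eq_iff ptrace_tensor_nth algebra_simps sum_subtractf)

text \<open>The trivial effect leaves the reduced state; orthonormality of \<alpha> removes the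
  cross terms.\<close>

lemma ptrace_schmidt_state:
  assumes "orthonormal_upto d \<alpha>" and nonneg: "\<And>i. i < d \<Longrightarrow> 0 \<le> lam i"
  shows "ptrace_A (tensor_op (mat 1) (mat 1) ** ketbra (schmidt_state d \<alpha> \<beta> lam) (schmidt_state d \<alpha> \<beta> lam))
    = (\<Sum>i<d. lam i *\<^sub>R ketbra (\<beta> i) (\<beta> i))"
proof -
  let ?\<psi> = "schmidt_state d \<alpha> \<beta> lam"
  let ?r = "\<lambda>m. complex_of_real (sqrt (lam m))"
  have ortho: "(\<Sum>k\<in>UNIV. cnj (\<alpha> n $ k) * \<alpha> m $ k) = (if n = m then 1 else 0)" if "m < d" "n < d" for m n
    using assms that by (simp add: orthonormal_upto_def cip_def)
  have nth: "?\<psi> $ (k, i) = (\<Sum>m<d. ?r m * \<alpha> m $ k * \<beta> m $ i)" for k i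
    by (simp add: schmidt_state_def tensor_vec_def mult.assoc) (simp add: scaleR_conv_of_real)
  have "ptrace_A (tensor_op (mat 1) (mat 1) ** ketbra ?\<psi> ?\<psi>) $ i $ j =
      (\<Sum>m<d. lam m *\<^sub>R ketbra (\<beta> m) (\<beta> m)) $ i $ j" for i j
  proof -
    have "ptrace_A (tensor_op (mat 1) (mat 1) ** ketbra ?\<psi> ?\<psi>) $ i $ j
        = (\<Sum>k\<in>UNIV. \<Sum>l\<in>UNIV. if k = l then ?\<psi> $ (l, i) * cnj (?\<psi> $ (k, j)) else 0)"
      unfolding ptrace_tensor_nth by (intro sum.cong refl) (simp add: mat_def)
    also have "\<dots> = (\<Sum>k\<in>UNIV. ?\<psi> $ (k, i) * cnj (?\<psi> $ (k, j)))"
      by simp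
    \<comment> \<open>The last factor is isolated because its sum over \<open>k\<close> is the inner
      product of \<open>\<alpha> n\<close> and \<open>\<alpha> m\<close>.\<close>
    also have "\<dots> = (\<Sum>k\<in>UNIV. \<Sum>m<d. \<Sum>n<d.
        (?r m * ?r n * \<beta> m $ i * cnj (\<beta> n $ j)) * (cnj (\<alpha> n $ k) * \<alpha> m $ k))"
      by (simp add: nth sum_product algebra_simps)
    also have "\<dots> = (\<Sum>m<d. \<Sum>n<d. (?r m * ?r n * \<beta> m $ i * cnj (\<beta> n $ j)) *
        (\<Sum>k\<in>UNIV. cnj (\<alpha> n $ k) * \<alpha> m $ k))"
      by (simp add: sum.swap[of _ _ UNIV] sum_distrib_left)
    also have "\<dots> = (\<Sum>m<d. \<Sum>n<d. if n = m then ?r m * ?r n * \<beta> m $ i * cnj (\<beta> n $ j) else 0)"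
      by (intro sum.cong refl) (simp add: ortho)
    also have "\<dots> = (\<Sum>m<d. ?r m * ?r m * \<beta> m $ i * cnj (\<beta> m $ j))"
      by simp
    also have "\<dots> = (\<Sum>m<d. of_real (lam m) * \<beta> m $ i * cnj (\<beta> m $ j))"
      using nonneg by (intro sum.cong refl) (simp flip: of_real_mult)
    finally show ?thesis
      by (simp add: ketbra_def algebra_simps) (simp add: scaleR_conv_of_real)
  qed
  then show ?thesis
    by (simp add: vec_eq_iff)
qed

text \<open>Otherwise monotonicity makes every coefficient after the first vanish, and the state is
  a product; for \<open>d = 0\<close> it is the zero vector, also a product.\<close>

lemma entangled_schmidt:
  assumes ent: "entangled (schmidt_state d \<alpha> \<beta> lam)"
    and decreasing: "\<And>i j. i \<le> j \<Longrightarrow> j < d \<Longrightarrow> lam j \<le> lam i"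
    and nonneg: "\<And>i. i < d \<Longrightarrow> 0 \<le> lam i"
  shows "2 \<le> d \<and> 0 < lam 1"
proof (rule ccontr)
  assume *: "\<not> ?thesis"
  have "lam i = 0" if "1 \<le> i" "i < d" for i
    using decreasing[OF that] nonneg[OF that(2)] that * by auto
  then have zero: "sqrt (lam i) *\<^sub>R tensor_vec (\<alpha> i) (\<beta> i) = 0" if "i \<in> {..<d} - {0}" for i
    using that by simp
  have "\<exists>u v. schmidt_state d \<alpha> \<beta> lam = tensor_vec u v"
  proof (cases "d = 0")
    case True
    then have "schmidt_state d \<alpha> \<beta> lam = tensor_vec 0 0"
      by (simp add: schmidt_state_def tensor_vec_def vec_eq_iff)
    then show ?thesis
      by blast
  next
    case False
    have "(\<Sum>i\<in>{..<d} - {0}. sqrt (lam i) *\<^sub>R tensor_vec (\<alpha> i) (\<beta> i)) = 0"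
      using zero by (intro sum.neutral) blast
    with False have "schmidt_state d \<alpha> \<beta> lam = sqrt (lam 0) *\<^sub>R tensor_vec (\<alpha> 0) (\<beta> 0)"
      unfolding schmidt_state_def by (subst sum.remove[of _ 0]) auto
    also have "\<dots> = tensor_vec (sqrt (lam 0) *\<^sub>R \<alpha> 0) (\<beta> 0)"
      by (simp add: tensor_vec_def vec_eq_iff)
    finally show ?thesis
      by blast
  qed
  with ent show False
    by (simp add: entangled_def)
qed


section \<open>The witness for a state in Schmidt form\<close>

lemma F_angle_block:
  "F_angle \<beta> \<gamma> Plus False = block \<beta> ((1 - cos (\<gamma> / 2)) / 8) (sin (\<gamma> / 2) / 8) ((1 + cos (\<gamma> / 2)) / 8)"
  "F_angle \<beta> \<gamma> Plus True = block \<beta> ((cos (\<gamma> / 2) - 1) / 8) (- sin (\<gamma> / 2) / 8) ((1 + cos (\<gamma> / 2)) / 8)"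
  "F_angle \<beta> \<gamma> Null False = block \<beta> ((1 - cos (\<gamma> / 2)) / 4) 0 0"
  "F_angle \<beta> \<gamma> Null True = block \<beta> 0 0 0"
  by (simp_all add: block_def scaleR_add_right scaleR_diff_right)

lemma block_cong: "a = a' \<Longrightarrow> b = b' \<Longrightarrow> e = e' \<Longrightarrow> block \<beta> a b e = block \<beta> a' b' e'"
  by simp

text \<open>Unless \<open>v\<close> and \<open>k\<close> both vanish, \<open>(sin g, cos g)\<close>
  is \<open>(- v, k)\<close> divided by its norm, so its pairing with \<open>(v, - k)\<close> is
  minimal among all angles. For \<open>k = 0\<close> a right angle with the sign of
  \<open>- v\<close> achieves this.\<close>

lemma rotation_minimum:
  fixes k v :: real
  assumes "0 \<le> k"
  defines "g \<equiv> (if k = 0 then sgn (- v) * pi else 2 * arctan (- v / k)) / 2"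
  shows "sin g * v - cos g * k = - sqrt (v\<^sup>2 + k\<^sup>2)"
proof (cases "k = 0")
  case True
  then show ?thesis
    by (cases v "0 :: real" rule: linorder_cases) (auto simp: g_def)
next
  case False
  with assms have "0 < k"
    by simp
  have root: "sqrt (1 + (- v / k)\<^sup>2) = sqrt (v\<^sup>2 + k\<^sup>2) / k"
  proof -
    have "1 + (- v / k)\<^sup>2 = (v\<^sup>2 + k\<^sup>2) / k\<^sup>2"
      using \<open>0 < k\<close> by (simp add: field_simps)
    then show ?thesis
      using \<open>0 < k\<close> by (simp add: real_sqrt_divide)
  qed
  have "0 < v\<^sup>2 + k\<^sup>2"
    using \<open>0 < k\<close> by (simp add: add_nonneg_pos)
  then have nz: "sqrt (v\<^sup>2 + k\<^sup>2) \<noteq> 0"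
    by (metis less_irrefl real_sqrt_eq_zero_cancel_iff)
  have "g = arctan (- v / k)"
    using False by (simp add: g_def)
  then have "sin g * v - cos g * k = - (v\<^sup>2 + k\<^sup>2) / sqrt (v\<^sup>2 + k\<^sup>2)"
    unfolding sin_arctan cos_arctan root using \<open>0 < k\<close>
    by (simp only: sin_arctan cos_arctan root) (simp add: field_simps power2_eq_square nz)
  also have "\<dots> = - sqrt (v\<^sup>2 + k\<^sup>2)"
    using \<open>0 < v\<^sup>2 + k\<^sup>2\<close> unfolding minus_divide_left[symmetric] by (simp only: real_div_sqrt less_imp_le)
  finally show ?thesis .
qed

text \<open>Compares the radicand in \<open>opt_value\<close> with the square of the term from which
  the root is subtracted; the right-hand side then decides the sign of the value.\<close>

lemma quadratic_gap:
  fixes a b e l :: real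
  assumes "a * e = b\<^sup>2"
  shows "(2 * b)\<^sup>2 + (l - a - e)\<^sup>2 - (l - a + e)\<^sup>2 = 4 * e * (2 * a - l)"
  using assms by (simp add: power_mult_distrib flip: assms) (simp add: algebra_simps power2_eq_square)

lemma cos_half_squared: "(cos (\<theta> / 2))\<^sup>2 = (1 + cos \<theta>) / 2" for \<theta> :: real
  using cos_double_cos[of "\<theta> / 2"] by simp

lemma sin_half_eq_0_iff: "sin (\<theta> / 2) = 0 \<longleftrightarrow> cos \<theta> = 1" for \<theta> :: real
  using cos_double_sin[of "\<theta> / 2"] by simp

text \<open>Entanglement enters as \<open>two_le\<close> and \<open>pos\<close>, supplied by
  \<open>entangled_schmidt\<close>.\<close>

locale schmidt_pair =
  fixes d :: nat and \<alpha> :: "nat \<Rightarrow> complex ^ 'a" and \<beta> :: "nat \<Rightarrow> complex ^ 'b"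
    and lam :: "nat \<Rightarrow> real"
  assumes alpha: "orthonormal_upto d \<alpha>" and beta: "orthonormal_upto d \<beta>" and two_le: "2 \<le> d"
    and nonneg: "i < d \<Longrightarrow> 0 \<le> lam i" and decreasing: "lam 1 \<le> lam 0" and pos: "0 < lam 1"
begin

section \<open>The reduced state and the coordinates of the conditional states\<close>

definition rho :: "complex ^ 'b ^ 'b" where
  "rho = (\<Sum>i<d. lam i *\<^sub>R ketbra (\<beta> i) (\<beta> i))"

definition rest :: "complex ^ 'b ^ 'b" where
  "rest = (\<Sum>i\<in>{2..<d}. lam i *\<^sub>R ketbra (\<beta> i) (\<beta> i))"

lemma rho_eq: "rho = block \<beta> (lam 0) 0 (lam 1) + rest"
proof -
  have "{..<d} = insert 0 (insert 1 {2..<d})"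
    using two_le by auto
  then show ?thesis
    by (simp add: rho_def rest_def block_def)
qed

lemma dual_cone_rest: "dual_cone rest"
  unfolding rest_def by (intro dual_cone_sum dual_cone_scaleR dual_cone_ketbra) (simp add: nonneg)

text \<open>The operator \<open>rest\<close> is built from Schmidt vectors orthogonal to
  \<open>\<beta> 0\<close> and \<open>\<beta> 1\<close>, hence is invisible to blocks.\<close>

lemma rtr_block_rho: "rtr (block \<beta> a b e ** rho) = a * lam 0 + e * lam 1"
proof -
  have "rtr (block \<beta> a b e ** rest) = 0"
    unfolding rest_def block_def V_hat_def
    using two_le by (simp add: rtr_mult_linear rtr_ketbra_ketbra cip_orthonormal[OF beta])
  then show ?thesis
    by (simp add: rho_eq matrix_add_ldistrib rtr_add rtr_block_block[OF beta two_le])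
qed

text \<open>\<open>coef_0\<close>, \<open>coef_V\<close> and \<open>coef_1\<close> are the entries
  a, b and e of the opening explanation.\<close>

definition coef_0 :: "real \<Rightarrow> real \<Rightarrow> real" where
  "coef_0 \<epsilon> \<theta> = \<epsilon> * (cos (\<theta> / 2))\<^sup>2 * lam 0"

definition coef_V :: "real \<Rightarrow> real \<Rightarrow> real" where
  "coef_V \<epsilon> \<theta> = \<epsilon> * (cos (\<theta> / 2) * sin (\<theta> / 2)) * (sqrt (lam 0) * sqrt (lam 1))"

definition coef_1 :: "real \<Rightarrow> real \<Rightarrow> real" where
  "coef_1 \<epsilon> \<theta> = \<epsilon> * (sin (\<theta> / 2))\<^sup>2 * lam 1"

lemmas coef_defs = coef_0_def coef_V_def coef_1_def

lemma coef_0_coef_1: "coef_0 \<epsilon> \<theta> * coef_1 \<epsilon> \<theta> = (coef_V \<epsilon> \<theta>)\<^sup>2"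
  using pos decreasing by (simp add: coef_defs power_mult_distrib) (simp add: power2_eq_square)

definition sgn_setting :: "setting \<Rightarrow> real" where
  "sgn_setting x = (if x then - 1 else 1)"

text \<open>The measured vector has real coordinates in the span of \<open>\<alpha> 0\<close> and
  \<open>\<alpha> 1\<close>, so only two Schmidt terms survive and no conjugation is
  visible.\<close>

lemma contract_e_vec:
  "contract (e_vec \<alpha> \<theta> x) (schmidt_state d \<alpha> \<beta> lam) =
    (cos (\<theta> / 2) * sqrt (lam 0)) *\<^sub>R \<beta> 0 + (sgn_setting x * sin (\<theta> / 2) * sqrt (lam 1)) *\<^sub>R \<beta> 1"
proof -
  let ?f = "\<lambda>i. sqrt (lam i) *\<^sub>R (cip (e_vec \<alpha> \<theta> x) (\<alpha> i) *s \<beta> i)"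
  have of_real_scale: "of_real r *s v = r *\<^sub>R v" for r :: real and v :: "complex ^ 'b"
    by (simp add: vec_eq_iff) (simp add: scaleR_conv_of_real)
  have e: "cip (e_vec \<alpha> \<theta> x) (\<alpha> i) =
      of_real (if i = 0 then cos (\<theta> / 2) else if i = 1 then sgn_setting x * sin (\<theta> / 2) else 0)"
    if "i < d" for i
    using that two_le
    by (simp add: e_vec_def cip_add_left cip_scaleR_left cip_orthonormal[OF alpha] sgn_setting_def)
      (simp add: scaleR_conv_of_real)
  have "{..<d} = insert 0 (insert 1 {2..<d})"
    using two_le by auto
  moreover have "(\<Sum>i\<in>{2..<d}. ?f i) = 0"
    by (intro sum.neutral) (simp add: e)
  ultimately have "(\<Sum>i<d. ?f i) = ?f 0 + ?f 1"
    by simp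
  then show ?thesis
    using two_le
    by (simp add: schmidt_state_def contract_sum contract_scaleR contract_tensor_vec e of_real_scale
        mult.commute del: of_real_mult)
qed

lemma sigma_Plus:
  "assemblage_of \<alpha> (schmidt_state d \<alpha> \<beta> lam) \<epsilon> \<theta> Plus x =
    block \<beta> (coef_0 \<epsilon> \<theta>) (sgn_setting x * coef_V \<epsilon> \<theta>) (coef_1 \<epsilon> \<theta>)"
proof -
  have "(sgn_setting x)\<^sup>2 = 1"
    by (simp add: sgn_setting_def)
  then show ?thesis
    using pos decreasing
    by (simp add: assemblage_of_def ptrace_scaleR ptrace_ketbra contract_e_vec
        ketbra_combination[of _ \<beta> _, simplified] block_scaleR power_mult_distrib coef_defs ac_simps)
qed

lemma sigma_Null:
  "assemblage_of \<alpha> (schmidt_state d \<alpha> \<beta> lam) \<epsilon> \<theta> Null x =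
    rho - assemblage_of \<alpha> (schmidt_state d \<alpha> \<beta> lam) \<epsilon> \<theta> Plus x"
  by (simp add: assemblage_of_def ptrace_diff ptrace_schmidt_state[OF alpha nonneg] rho_def)

section \<open>Feasibility of the witness at every angle\<close>

text \<open>Strategies with equal answers give nonnegative multiples of the projectors onto
  \<open>\<beta> 1\<close> and \<open>\<beta> 0\<close>. Those with different answers give blocks of
  determinant zero, since \<open>(1 - C) * (1 + C) = S\<^sup>2\<close>.\<close>

lemma dual_cone_strategy_op: "dual_cone (strategy_op (F_angle \<beta> \<gamma>) l)"
proof -
  define C S where CS: "C = cos (\<gamma> / 2)" "S = sin (\<gamma> / 2)"
  have C: "- 1 \<le> C" "C \<le> 1"
    by (simp_all add: CS)
  have S: "(1 - C) / 8 * ((1 + C) / 8) = (S / 8)\<^sup>2" "(1 - C) / 8 * ((1 + C) / 8) = (- S / 8)\<^sup>2"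
    by (simp_all add: CS power_divide sin_squared_eq) (simp_all add: algebra_simps power2_eq_square)
  have "dual_cone (block \<beta> 0 0 ((1 + C) / 4))"
    using C by (intro dual_cone_diagonal) auto
  moreover have "dual_cone (block \<beta> ((1 - C) / 4) 0 0)"
    using C by (intro dual_cone_diagonal) auto
  moreover have "dual_cone (block \<beta> ((1 - C) / 8) (S / 8) ((1 + C) / 8))"
    using C by (intro dual_cone_block[OF _ _ S(1)]) auto
  moreover have "dual_cone (block \<beta> ((1 - C) / 8) (- S / 8) ((1 + C) / 8))"
    using C by (intro dual_cone_block[OF _ _ S(2)]) auto
  moreover have "strategy_op (F_angle \<beta> \<gamma>) (strat Plus Plus) = block \<beta> 0 0 ((1 + C) / 4)"
    unfolding strategy_op_strat F_angle_block block_add CS by (rule block_cong) (auto simp: field_simps)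
  moreover have "strategy_op (F_angle \<beta> \<gamma>) (strat Plus Null) = block \<beta> ((1 - C) / 8) (S / 8) ((1 + C) / 8)"
    unfolding strategy_op_strat F_angle_block block_add CS by (rule block_cong) auto
  moreover have "strategy_op (F_angle \<beta> \<gamma>) (strat Null Plus) = block \<beta> ((1 - C) / 8) (- S / 8) ((1 + C) / 8)"
    unfolding strategy_op_strat F_angle_block block_add CS by (rule block_cong) (auto simp: field_simps)
  moreover have "strategy_op (F_angle \<beta> \<gamma>) (strat Null Null) = block \<beta> ((1 - C) / 4) 0 0"
    unfolding strategy_op_strat F_angle_block block_add CS by (rule block_cong) auto
  moreover obtain a b where "l = strat a b"
    using strat_eq by blast
  ultimately show ?thesis
    by (cases a; cases b) simp_all
qed

lemma dual_feasible_F_angle: "dual_feasible (F_angle \<beta> \<gamma>)"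
proof -
  have "hermitian (F_angle \<beta> \<gamma> a x)" for a x
    by (cases a; cases x) (simp_all only: F_angle_block hermitian_block)
  moreover have "(\<Sum>l\<in>UNIV. trace (strategy_op (F_angle \<beta> \<gamma>) l)) = 1"
    by (simp add: sum_strategy strategy_op_strat F_angle_block block_add trace_block[OF beta two_le]
        del: F_angle.simps) (simp add: field_simps)
  ultimately show ?thesis
    by (simp add: dual_feasible_iff dual_cone_strategy_op dual_cone_imp_psd del: F_angle.simps)
qed

section \<open>Value of the witness and its sign\<close>

context
  fixes \<epsilon> \<theta> :: real and \<sigma> :: "'b assemblage"
  assumes \<sigma>_def: "\<sigma> = assemblage_of \<alpha> (schmidt_state d \<alpha> \<beta> lam) \<epsilon> \<theta>"
begin

lemma K_plus_eq: "K_plus (lam 0) \<sigma> x = lam 0 - coef_0 \<epsilon> \<theta> - coef_1 \<epsilon> \<theta>"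
  by (simp add: \<sigma>_def K_plus_def sigma_Plus rtr_block[OF beta two_le])

lemma rtr_V_hat_eq: "rtr (V_hat \<beta> ** (\<sigma> Plus False - \<sigma> Plus True)) = 4 * coef_V \<epsilon> \<theta>"
  by (simp add: \<sigma>_def sigma_Plus V_hat_block block_diff rtr_block_block[OF beta two_le] sgn_setting_def)

lemma rtr_sigma_z_eq: "rtr (sigma_z \<beta> ** \<sigma> Plus x) = coef_0 \<epsilon> \<theta> - coef_1 \<epsilon> \<theta>"
  by (simp add: \<sigma>_def sigma_Plus sigma_z_block rtr_block_block[OF beta two_le])

text \<open>The \<open>Null\<close> operators of the witness see only \<open>\<beta> 0\<close>, so
  \<open>lam 0\<close> is all that enters from the reduced state.\<close>

lemma witness_value_F_angle:
  "witness_value (F_angle \<beta> \<gamma>) \<sigma> =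
    (lam 0 - (coef_0 \<epsilon> \<theta> - coef_1 \<epsilon> \<theta>) + sin (\<gamma> / 2) * off_diag \<beta> \<sigma>
      - cos (\<gamma> / 2) * K_plus (lam 0) \<sigma> False) / 4"
  unfolding witness_value_def off_diag_def rtr_V_hat_eq K_plus_eq
  by (simp add: sum_outcome sum_setting F_angle_block \<sigma>_def sigma_Null sigma_Plus sgn_setting_def
      mult_diff_matrix rtr_diff rtr_block_rho rtr_block_block[OF beta two_le] del: F_angle.simps)
    (simp add: field_simps)

end

text \<open>Bounding \<open>lam 1\<close> by \<open>lam 0\<close> leaves at most
  \<open>\<epsilon> * lam 0\<close>. This is the nonnegativity of \<open>K_plus\<close>.\<close>

lemma coef_sum_le:
  assumes "0 \<le> \<epsilon>" "\<epsilon> \<le> 1"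
  shows "coef_0 \<epsilon> \<theta> + coef_1 \<epsilon> \<theta> \<le> lam 0"
proof -
  have "coef_0 \<epsilon> \<theta> + coef_1 \<epsilon> \<theta> \<le> \<epsilon> * ((cos (\<theta> / 2))\<^sup>2 * lam 0 + (sin (\<theta> / 2))\<^sup>2 * lam 0)"
    using assms decreasing by (simp add: algebra_simps mult_left_mono mult_right_mono coef_defs)
  also have "\<dots> = \<epsilon> * lam 0"
    by (simp flip: distrib_right)
  also have "\<dots> \<le> lam 0"
    using assms pos decreasing by (simp add: mult_left_le_one_le)
  finally show ?thesis .
qed

lemma coef_nonneg:
  assumes "0 \<le> \<epsilon>"
  shows "0 \<le> coef_0 \<epsilon> \<theta>" "0 \<le> coef_1 \<epsilon> \<theta>"
  using assms pos decreasing by (simp_all add: coef_defs)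

text \<open>With a, b, e as above and l = \<open>lam 0\<close>, this is the smaller root \<mu> of
  \<open>(l - a - 2 * \<mu>) * (e - 2 * \<mu>) = b\<^sup>2\<close>.\<close>

definition opt_value :: "real \<Rightarrow> real \<Rightarrow> real" where
  "opt_value \<epsilon> \<theta> = (lam 0 - coef_0 \<epsilon> \<theta> + coef_1 \<epsilon> \<theta>
     - sqrt ((2 * coef_V \<epsilon> \<theta>)\<^sup>2 + (lam 0 - coef_0 \<epsilon> \<theta> - coef_1 \<epsilon> \<theta>)\<^sup>2)) / 4"

lemma witness_value_F_star:
  assumes "0 \<le> \<epsilon>" "\<epsilon> \<le> 1" and \<sigma>: "\<sigma> = assemblage_of \<alpha> (schmidt_state d \<alpha> \<beta> lam) \<epsilon> \<theta>"
  shows "witness_value (F_star \<beta> (lam 0) \<sigma>) \<sigma> = opt_value \<epsilon> \<theta>"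
proof -
  have K: "0 \<le> K_plus (lam 0) \<sigma> False"
    unfolding K_plus_eq[OF \<sigma>] using coef_sum_le[OF assms(1,2), of \<theta>] by linarith
  have v: "off_diag \<beta> \<sigma> = 2 * coef_V \<epsilon> \<theta>"
    by (simp add: off_diag_def rtr_V_hat_eq[OF \<sigma>])
  show ?thesis
    \<comment> \<open>Regrouping isolates the difference of the sine and cosine terms, to which
      \<open>rotation_minimum\<close> applies.\<close>
    unfolding F_star_def witness_value_F_angle[OF \<sigma>] add_diff_eq[symmetric]
      rotation_minimum[OF K, of "off_diag \<beta> \<sigma>", folded gamma_angle_def]
    by (simp add: opt_value_def v K_plus_eq[OF \<sigma>])
qed

text \<open>Both compared terms are nonnegative, so squaring is harmless, and
  \<open>quadratic_gap\<close> factors the difference of the squares.\<close>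

lemma opt_value_neg_iff:
  assumes "0 \<le> \<epsilon>" "\<epsilon> \<le> 1"
  shows "opt_value \<epsilon> \<theta> < 0 \<longleftrightarrow> sin (\<theta> / 2) \<noteq> 0 \<and> 1 / 2 < \<epsilon> * (cos (\<theta> / 2))\<^sup>2"
proof -
  let ?s = "lam 0 - coef_0 \<epsilon> \<theta> + coef_1 \<epsilon> \<theta>"
  let ?t = "(2 * coef_V \<epsilon> \<theta>)\<^sup>2 + (lam 0 - coef_0 \<epsilon> \<theta> - coef_1 \<epsilon> \<theta>)\<^sup>2"
  have "0 \<le> ?s"
    using coef_sum_le[OF assms, of \<theta>] coef_nonneg[OF assms(1), of \<theta>] by linarith
  then have "opt_value \<epsilon> \<theta> < 0 \<longleftrightarrow> ?s\<^sup>2 < ?t"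
    unfolding opt_value_def by (smt (verit) real_less_rsqrt real_le_lsqrt divide_less_0_iff zero_le_power2)
  also have "\<dots> \<longleftrightarrow> 0 < 4 * coef_1 \<epsilon> \<theta> * (2 * coef_0 \<epsilon> \<theta> - lam 0)"
    using quadratic_gap[OF coef_0_coef_1[of \<epsilon> \<theta>], of "lam 0"] by linarith
  also have "\<dots> \<longleftrightarrow> 0 < coef_1 \<epsilon> \<theta> \<and> lam 0 < 2 * coef_0 \<epsilon> \<theta>"
    using coef_nonneg[OF assms(1), of \<theta>] by (auto simp: zero_less_mult_iff)
  also have "\<dots> \<longleftrightarrow> 0 < coef_1 \<epsilon> \<theta> \<and> 1 / 2 < \<epsilon> * (cos (\<theta> / 2))\<^sup>2"
  proof -
    have "lam 0 < 2 * coef_0 \<epsilon> \<theta> \<longleftrightarrow> lam 0 * 1 < lam 0 * (2 * (\<epsilon> * (cos (\<theta> / 2))\<^sup>2))"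
      by (simp add: coef_defs ac_simps)
    also have "\<dots> \<longleftrightarrow> 1 < 2 * (\<epsilon> * (cos (\<theta> / 2))\<^sup>2)"
      using pos decreasing by (subst mult_less_cancel_left_pos) auto
    finally show ?thesis
      by auto
  qed
  \<comment> \<open>For \<open>\<epsilon> = 0\<close> both sides are false.\<close>
  also have "\<dots> \<longleftrightarrow> sin (\<theta> / 2) \<noteq> 0 \<and> 1 / 2 < \<epsilon> * (cos (\<theta> / 2))\<^sup>2"
    using assms pos by (cases "\<epsilon> = 0") (auto simp: coef_defs zero_less_mult_iff)
  finally show ?thesis .
qed

section \<open>Primal points attaining the value\<close>

text \<open>A diagonal hidden state \<open>X\<close> for the strategy that always answers
  \<open>Plus\<close> determines the other three through the marginals. The numbers \<open>p\<close>
  and \<open>q\<close> are the diagonal entries of the slack of the strategies with different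
  answers, which is rank one.\<close>

lemma primal_point:
  fixes \<mu> x0 x1 p q b :: real
  assumes "\<mu> \<le> 0" "\<mu> \<le> x0" "\<mu> \<le> x1"
    and "p = coef_0 \<epsilon> \<theta> - x0 - \<mu>" "q = coef_1 \<epsilon> \<theta> - x1 - \<mu>"
    and "0 \<le> p" "0 \<le> q" "p * q = (coef_V \<epsilon> \<theta>)\<^sup>2"
    and "\<mu> \<le> lam 0 - 2 * coef_0 \<epsilon> \<theta> + x0" "\<mu> \<le> lam 1 - 2 * coef_1 \<epsilon> \<theta> + x1"
    and \<sigma>: "\<sigma> = assemblage_of \<alpha> (schmidt_state d \<alpha> \<beta> lam) \<epsilon> \<theta>"
  shows "\<exists>S. (\<forall>a x. (\<Sum>l\<in>UNIV. D a x l *\<^sub>R S l) = \<sigma> a x) \<and> (\<forall>l. dual_cone (S l - \<mu> *\<^sub>R mat 1))"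
proof -
  define X where "X = block \<beta> x0 0 x1"
  define T where "T = (\<lambda>a b. case (a, b) of
      (Plus, Plus) \<Rightarrow> X
    | (Plus, Null) \<Rightarrow> \<sigma> Plus False - X
    | (Null, Plus) \<Rightarrow> \<sigma> Plus True - X
    | (Null, Null) \<Rightarrow> rho - \<sigma> Plus False - \<sigma> Plus True + X)"
  define S where "S = (\<lambda>l :: strategy. T (l False) (l True))"
  have S: "S (strat a b) = T a b" for a b
    by (simp add: S_def strat_def)
  have D: "D c x (strat a b) = (if c = (if x then b else a) then 1 else 0)" for a b c x
    by (simp add: D_def strat_def)
  have "(\<Sum>l\<in>UNIV. D a x l *\<^sub>R S l) = \<sigma> a x" for a x
    by (cases a; cases x) (simp_all add: sum_strategy S D T_def sigma_Null[of \<epsilon> \<theta>, folded \<sigma>])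
  moreover have "dual_cone (T a b - \<mu> *\<^sub>R mat 1)" for a b
  proof -
    \<comment> \<open>On the complement of the block the slack is \<open>- \<mu>\<close> times a
      projector, nonnegative because \<open>\<mu> \<le> 0\<close>.\<close>
    have split: "block \<beta> u v w - \<mu> *\<^sub>R mat 1 =
        block \<beta> (u - \<mu>) v (w - \<mu>) + (- \<mu>) *\<^sub>R (mat 1 - block \<beta> 1 0 1)" for u v w
    proof -
      have "block \<beta> (u - \<mu>) v (w - \<mu>) = block \<beta> u v w - \<mu> *\<^sub>R block \<beta> 1 0 1"
        by (simp add: block_scaleR block_diff)
      then show ?thesis
        by (simp add: algebra_simps)
    qed
    have lift: "dual_cone (block \<beta> u v w - \<mu> *\<^sub>R mat 1)" if "dual_cone (block \<beta> (u - \<mu>) v (w - \<mu>))" for u v w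
      unfolding split using that dual_cone_complement[OF beta two_le] assms(1)
      by (intro dual_cone_add dual_cone_scaleR) auto
    have "dual_cone (X - \<mu> *\<^sub>R mat 1)"
      unfolding X_def using assms by (intro lift dual_cone_diagonal) auto
    moreover have "dual_cone (\<sigma> Plus x - X - \<mu> *\<^sub>R mat 1)" for x
      unfolding X_def \<sigma> sigma_Plus block_diff using assms
      by (intro lift dual_cone_block) (auto simp: sgn_setting_def)
    \<comment> \<open>The off-diagonal entries of the two settings cancel, leaving a diagonal block
      plus \<open>rest\<close>.\<close>
    moreover have "dual_cone (rho - \<sigma> Plus False - \<sigma> Plus True + X - \<mu> *\<^sub>R mat 1)"
    proof -
      have "rho - \<sigma> Plus False - \<sigma> Plus True + X - \<mu> *\<^sub>R mat 1 = (block \<beta> (lam 0) 0 (lam 1)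
          - \<sigma> Plus False - \<sigma> Plus True + X - \<mu> *\<^sub>R mat 1) + rest"
        by (simp add: rho_eq algebra_simps)
      also have "dual_cone \<dots>"
        unfolding X_def \<sigma> sigma_Plus block_diff block_add using assms
        by (intro dual_cone_add dual_cone_rest lift) (auto simp: sgn_setting_def intro!: dual_cone_diagonal)
      finally show ?thesis .
    qed
    ultimately show ?thesis
      by (cases a; cases b) (simp_all add: T_def)
  qed
  ultimately show ?thesis
    by (intro exI[of _ S]) (auto simp: S_def)
qed

text \<open>In the degenerate cases the value is 0 and an LHS model attains it. Otherwise the choice
  of \<open>X\<close> makes the slack vanish at \<open>\<beta> 1\<close> for two \<open>Plus\<close>
  answers and at \<open>\<beta> 0\<close> for two \<open>Null\<close> answers.\<close>

lemma optimality:
  assumes \<epsilon>: "0 \<le> \<epsilon>" "\<epsilon> \<le> 1"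
    and regime: "\<epsilon> = 0 \<or> sin (\<theta> / 2) = 0 \<or> 1 / 2 \<le> \<epsilon> * (cos (\<theta> / 2))\<^sup>2"
    and \<sigma>: "\<sigma> = assemblage_of \<alpha> (schmidt_state d \<alpha> \<beta> lam) \<epsilon> \<theta>"
  shows "\<exists>S. (\<forall>a x. (\<Sum>l\<in>UNIV. D a x l *\<^sub>R S l) = \<sigma> a x) \<and>
    (\<forall>l. dual_cone (S l - opt_value \<epsilon> \<theta> *\<^sub>R mat 1))"
proof (cases "\<epsilon> = 0 \<or> sin (\<theta> / 2) = 0")
  case True
  then have zero: "coef_V \<epsilon> \<theta> = 0" "coef_1 \<epsilon> \<theta> = 0"
    by (auto simp: coef_defs)
  have "opt_value \<epsilon> \<theta> = 0"
    using coef_sum_le[OF \<epsilon>, of \<theta>] unfolding opt_value_def zero by simp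
  then show ?thesis
    using zero coef_sum_le[OF \<epsilon>, of \<theta>] coef_nonneg[OF \<epsilon>(1), of \<theta>] pos
    \<comment> \<open>Both settings produce the same states, so the two constant strategies suffice,
      with \<open>X\<close> equal to \<open>\<sigma> Plus x\<close>.\<close>
    by (intro primal_point[OF _ _ _ refl refl _ _ _ _ _ \<sigma>, of _ "coef_0 \<epsilon> \<theta>" 0]) auto
next
  case False
  with regime have half: "1 / 2 \<le> \<epsilon> * (cos (\<theta> / 2))\<^sup>2"
    by blast
  define a b e \<mu> where abe: "a = coef_0 \<epsilon> \<theta>" "b = coef_V \<epsilon> \<theta>" "e = coef_1 \<epsilon> \<theta>"
    and \<mu>: "\<mu> = opt_value \<epsilon> \<theta>"
  define r where "r = sqrt ((2 * b)\<^sup>2 + (lam 0 - a - e)\<^sup>2)"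
  have \<mu>_eq: "\<mu> = (lam 0 - a + e - r) / 4"
    by (simp add: \<mu> opt_value_def r_def abe)
  have a_e: "a * e = b\<^sup>2" "0 \<le> e" "a + e \<le> lam 0"
    using coef_0_coef_1 coef_nonneg[OF \<epsilon>(1)] coef_sum_le[OF \<epsilon>] by (simp_all add: abe)
  have a: "lam 0 \<le> 2 * a"
    using mult_right_mono[OF half, of "lam 0"] pos decreasing by (simp add: abe coef_defs)
  \<comment> \<open>This keeps the slack of two \<open>Null\<close> answers nonnegative at
    \<open>\<beta> 1\<close>.\<close>
  have e: "2 * e \<le> lam 1"
  proof -
    have "\<epsilon> * (sin (\<theta> / 2))\<^sup>2 = \<epsilon> - \<epsilon> * (cos (\<theta> / 2))\<^sup>2"
      by (simp add: sin_squared_eq algebra_simps)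
    then have "\<epsilon> * (sin (\<theta> / 2))\<^sup>2 \<le> 1 / 2"
      using half \<epsilon> by linarith
    from mult_right_mono[OF this, of "lam 1"] show ?thesis
      using pos by (simp add: abe coef_defs)
  qed
  have r: "r\<^sup>2 = (2 * b)\<^sup>2 + (lam 0 - a - e)\<^sup>2" "\<bar>lam 0 - a - e\<bar> \<le> r"
    by (simp_all add: r_def real_le_rsqrt)
  have "0 \<le> 4 * e * (2 * a - lam 0)"
    using a a_e by simp
  then have "lam 0 - a + e \<le> r"
    unfolding r_def using quadratic_gap[OF a_e(1), of "lam 0"] by (intro real_le_rsqrt) linarith
  then have \<mu>_le: "\<mu> \<le> 0"
    by (simp add: \<mu>_eq)
  \<comment> \<open>In these factors the product is a difference of squares, which reduces to
    \<open>b\<^sup>2\<close> by the choice of \<open>r\<close>.\<close>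
  have p: "a - (\<mu> + 2 * a - lam 0) - \<mu> = (r + (lam 0 - a - e)) / 2"
    and q: "e - \<mu> - \<mu> = (r - (lam 0 - a - e)) / 2"
    by (simp_all add: \<mu>_eq field_simps)
  have "(r + (lam 0 - a - e)) / 2 * ((r - (lam 0 - a - e)) / 2) = (r\<^sup>2 - (lam 0 - a - e)\<^sup>2) / 4"
    by (simp add: power2_eq_square field_simps)
  also have "\<dots> = b\<^sup>2"
    by (simp add: r(1) power_mult_distrib)
  finally have pq: "(a - (\<mu> + 2 * a - lam 0) - \<mu>) * (e - \<mu> - \<mu>) = b\<^sup>2"
    by (simp only: p q)
  have nn: "0 \<le> a - (\<mu> + 2 * a - lam 0) - \<mu>" "0 \<le> e - \<mu> - \<mu>"
    unfolding p q using r(2) by auto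
  show ?thesis
    unfolding \<mu>[symmetric]
    by (rule primal_point[OF \<mu>_le _ _ refl refl _ _ _ _ _ \<sigma>, of "\<mu> + 2 * a - lam 0" \<mu>])
      (use a a_e e nn pq in \<open>simp_all add: abe\<close>)
qed

section \<open>Overlap, critical efficiency and its limit\<close>

lemma overlap_eq: "overlap \<alpha> \<theta> = (cos \<theta>)\<^sup>2"
proof -
  have "cip (e_vec \<alpha> \<theta> False) (e_vec \<alpha> \<theta> True) = of_real ((cos (\<theta> / 2))\<^sup>2 - (sin (\<theta> / 2))\<^sup>2)"
    by (simp add: e_vec_def cip_add_left cip_diff_right cip_scaleR_left cip_scaleR_right
        cip_first[OF alpha two_le] power2_eq_square) (simp add: scaleR_conv_of_real)
  also have "(cos (\<theta> / 2))\<^sup>2 - (sin (\<theta> / 2))\<^sup>2 = cos \<theta>"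
    using cos_double[of "\<theta> / 2"] by simp
  finally show ?thesis
    by (simp add: overlap_def)
qed

lemma star_value_neg_iff:
  assumes "0 \<le> \<epsilon>" "\<epsilon> \<le> 1"
  shows "star_value \<alpha> \<beta> (lam 0) (schmidt_state d \<alpha> \<beta> lam) \<epsilon> \<theta> < 0 \<longleftrightarrow>
    cos \<theta> \<noteq> 1 \<and> 1 < \<epsilon> * (1 + cos \<theta>)"
  using assms
  by (simp add: star_value_def Let_def witness_value_F_star opt_value_neg_iff cos_half_squared
      sin_half_eq_0_iff)

text \<open>The detecting efficiencies form an interval open at
  \<open>1 / (1 + cos \<theta>)\<close>. It is nonempty because \<open>cos \<theta>\<close> is
  positive, which also makes the cosine the square root of the overlap.\<close>

lemma critical_efficiency_eq:
  assumes "0 < cos \<theta>" "cos \<theta> \<noteq> 1"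
  shows "critical_efficiency \<alpha> \<beta> (lam 0) (schmidt_state d \<alpha> \<beta> lam) \<theta> = 1 / (1 + sqrt (overlap \<alpha> \<theta>))"
proof -
  have "{\<epsilon> \<in> {0..1}. star_value \<alpha> \<beta> (lam 0) (schmidt_state d \<alpha> \<beta> lam) \<epsilon> \<theta> < 0} = {1 / (1 + cos \<theta>)<..1}"
  proof (intro set_eqI iffI)
    fix \<epsilon> assume \<epsilon>: "\<epsilon> \<in> {1 / (1 + cos \<theta>)<..1}"
    have "0 < 1 / (1 + cos \<theta>)"
      using assms by simp
    with \<epsilon> have "0 < \<epsilon>"
      by (metis greaterThanAtMost_iff less_trans)
    moreover have "1 < \<epsilon> * (1 + cos \<theta>)"
      using \<epsilon> assms by (simp add: field_simps)
    ultimately show "\<epsilon> \<in> {\<epsilon> \<in> {0..1}. star_value \<alpha> \<beta> (lam 0) (schmidt_state d \<alpha> \<beta> lam) \<epsilon> \<theta> < 0}"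
      using \<epsilon> assms star_value_neg_iff[of \<epsilon> \<theta>] by simp
  qed (use assms star_value_neg_iff in \<open>auto simp: field_simps\<close>)
  moreover have "1 / (1 + cos \<theta>) < 1"
    using assms by simp
  ultimately show ?thesis
    using assms by (simp add: critical_efficiency_def overlap_eq)
qed

lemma overlap_to_one_limit: "((\<lambda>\<theta>. 1 / (1 + sqrt (overlap \<alpha> \<theta>))) \<longlongrightarrow> 1 / 2) (overlap_to_one \<alpha>)"
proof -
  have "filterlim (overlap \<alpha>) (at_left 1) (overlap_to_one \<alpha>)"
    unfolding overlap_to_one_def
    by (rule filterlim_mono[OF filterlim_filtercomap order_refl]) simp
  then have "(overlap \<alpha> \<longlongrightarrow> 1) (overlap_to_one \<alpha>)"
    by (rule filterlim_mono) (simp_all add: at_within_le_nhds)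
  then show ?thesis
    by (auto intro!: tendsto_eq_intros)
qed

text \<open>Approach from the left excludes overlap 1, and the principal part of the filter fixes
  the sign of the cosine.\<close>

lemma eventually_overlap_to_one: "\<forall>\<^sub>F \<theta> in overlap_to_one \<alpha>. 0 < cos \<theta> \<and> cos \<theta> \<noteq> 1"
proof -
  have "\<forall>\<^sub>F r in at_left (1 :: real). r < 1"
    by (simp add: eventually_at_filter)
  then have "\<forall>\<^sub>F \<theta> in filtercomap (overlap \<alpha>) (at_left 1). overlap \<alpha> \<theta> < 1"
    by (rule eventually_filtercomapI)
  then show ?thesis
    unfolding overlap_to_one_def eventually_inf_principal
    by (rule eventually_mono) (auto simp: overlap_eq)
qed

lemma critical_efficiency_limit:
  "(critical_efficiency \<alpha> \<beta> (lam 0) (schmidt_state d \<alpha> \<beta> lam) \<longlongrightarrow> 1 / 2) (overlap_to_one \<alpha>)"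
  using eventually_overlap_to_one
  by (intro Lim_transform_eventually[OF overlap_to_one_limit])
    (auto elim!: eventually_mono simp: critical_efficiency_eq)

lemma eventually_violation:
  assumes "1 / 2 < \<epsilon>" "\<epsilon> \<le> 1"
  shows "\<forall>\<^sub>F \<theta> in overlap_to_one \<alpha>. star_value \<alpha> \<beta> (lam 0) (schmidt_state d \<alpha> \<beta> lam) \<epsilon> \<theta> < 0"
  using order_tendstoD(2)[OF overlap_to_one_limit assms(1)] eventually_overlap_to_one
proof eventually_elim
  case (elim \<theta>)
  then show ?case
    using assms by (simp add: star_value_neg_iff overlap_eq field_simps)
qed

text \<open>An eventual statement yields a witness only along a nontrivial filter; an explicit angle
  is given instead.\<close>

lemma ex_violation:
  assumes "1 / 2 < \<epsilon>" "\<epsilon> \<le> 1"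
  shows "\<exists>\<theta>. star_value \<alpha> \<beta> (lam 0) (schmidt_state d \<alpha> \<beta> lam) \<epsilon> \<theta> < 0"
proof
  \<comment> \<open>This choice gives
    \<open>\<epsilon> * (1 + cos \<theta>) = \<epsilon> + 1 / 2\<close>, which exceeds 1.\<close>
  have "cos (arccos (1 / (2 * \<epsilon>))) = 1 / (2 * \<epsilon>)"
    using assms by (intro cos_arccos) (auto simp: field_simps)
  then show "star_value \<alpha> \<beta> (lam 0) (schmidt_state d \<alpha> \<beta> lam) \<epsilon> (arccos (1 / (2 * \<epsilon>))) < 0"
    using assms by (simp add: star_value_neg_iff field_simps)
qed

end

theorem mainTheorem2:
  fixes \<alpha> :: "nat \<Rightarrow> complex ^ 'a" and \<beta> :: "nat \<Rightarrow> complex ^ 'b"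
    and lam :: "nat \<Rightarrow> real" and d :: nat and \<psi> :: "complex ^ ('a::finite \<times> 'b::finite)"
  assumes d_def: "d = min CARD('a) CARD('b)"
    and alpha: "orthonormal_upto d \<alpha>"
    and beta: "orthonormal_upto d \<beta>"
    and lam_nonneg: "\<forall>i<d. 0 \<le> lam i"
    and lam_decreasing: "\<forall>i j. i \<le> j \<longrightarrow> j < d \<longrightarrow> lam j \<le> lam i"
    and lam_sum: "(\<Sum>i<d. \<bar>lam i\<bar>) = 1"
    and psi_def: "\<psi> = schmidt_state d \<alpha> \<beta> lam"
    and psi_entangled: "entangled \<psi>"
  shows
    "(\<forall>\<epsilon> \<theta> \<sigma> F. 0 \<le> \<epsilon> \<longrightarrow> \<epsilon> \<le> 1 \<longrightarrow> \<sigma> = assemblage_of \<alpha> \<psi> \<epsilon> \<theta> \<longrightarrow> F = F_star \<beta> (lam 0) \<sigma> \<longrightarrow>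
        (\<forall>x. 0 \<le> K_plus (lam 0) \<sigma> x) \<and>
        dual_feasible F \<and>
        steering_witness F \<and>
        (\<forall>x. witness_value F \<sigma> =
           (1 / 4) * (lam 0 - rtr (sigma_z \<beta> ** \<sigma> Plus x)
                      - sqrt ((rtr (V_hat \<beta> ** (\<sigma> Plus False - \<sigma> Plus True)) / 2)\<^sup>2
                              + (K_plus (lam 0) \<sigma> x)\<^sup>2))) \<and>
        (\<epsilon> = 0 \<or> sin (\<theta> / 2) = 0 \<or> 1 / 2 \<le> \<epsilon> * (cos (\<theta> / 2))\<^sup>2 \<longrightarrow>
           primal_optimum \<sigma> (witness_value F \<sigma>) \<and> dual_optimal \<sigma> F)) \<and>
     (critical_efficiency \<alpha> \<beta> (lam 0) \<psi> \<longlongrightarrow> 1 / 2) (overlap_to_one \<alpha>) \<and>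
     (\<forall>\<epsilon>. 1 / 2 < \<epsilon> \<longrightarrow> \<epsilon> \<le> 1 \<longrightarrow>
        (\<forall>\<^sub>F \<theta> in overlap_to_one \<alpha>. star_value \<alpha> \<beta> (lam 0) \<psi> \<epsilon> \<theta> < 0) \<and>
        (\<exists>\<theta>. star_value \<alpha> \<beta> (lam 0) \<psi> \<epsilon> \<theta> < 0))"
proof -
  have two: "2 \<le> d" and pos: "0 < lam 1"
    using entangled_schmidt[of d \<alpha> \<beta> lam] psi_entangled lam_decreasing lam_nonneg psi_def by auto
  interpret schmidt_pair d \<alpha> \<beta> lam
    using alpha beta two pos lam_nonneg lam_decreasing by unfold_locales auto
  have "(\<forall>x. 0 \<le> K_plus (lam 0) \<sigma> x) \<and> dual_feasible F \<and> steering_witness F \<and>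
      (\<forall>x. witness_value F \<sigma> =
         (1 / 4) * (lam 0 - rtr (sigma_z \<beta> ** \<sigma> Plus x)
                    - sqrt ((rtr (V_hat \<beta> ** (\<sigma> Plus False - \<sigma> Plus True)) / 2)\<^sup>2
                            + (K_plus (lam 0) \<sigma> x)\<^sup>2))) \<and>
      (\<epsilon> = 0 \<or> sin (\<theta> / 2) = 0 \<or> 1 / 2 \<le> \<epsilon> * (cos (\<theta> / 2))\<^sup>2 \<longrightarrow>
         primal_optimum \<sigma> (witness_value F \<sigma>) \<and> dual_optimal \<sigma> F)"
    if \<epsilon>: "0 \<le> \<epsilon>" "\<epsilon> \<le> 1" and "\<sigma> = assemblage_of \<alpha> \<psi> \<epsilon> \<theta>" and F: "F = F_star \<beta> (lam 0) \<sigma>"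
    for \<epsilon> \<theta> :: real and \<sigma> F :: "'b assemblage"
  proof (intro conjI allI impI)
    have \<sigma>: "\<sigma> = assemblage_of \<alpha> (schmidt_state d \<alpha> \<beta> lam) \<epsilon> \<theta>"
      using that psi_def by simp
    have val: "witness_value F \<sigma> = opt_value \<epsilon> \<theta>"
      unfolding F by (rule witness_value_F_star[OF \<epsilon> \<sigma>])
    show "0 \<le> K_plus (lam 0) \<sigma> x" for x
      using coef_sum_le[OF \<epsilon>, of \<theta>] by (simp add: K_plus_eq[OF \<sigma>])
    show feasible: "dual_feasible F"
      by (simp add: F F_star_def dual_feasible_F_angle)
    \<comment> \<open>Serves both the bound for LHS models and the optimality certificate.\<close>
    have cone: "dual_cone (strategy_op F l)" for l
      by (simp add: F F_star_def dual_cone_strategy_op)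
    then show "steering_witness F"
      by (rule steering_witness_if_dual_cone)
    show "witness_value F \<sigma> = (1 / 4) * (lam 0 - rtr (sigma_z \<beta> ** \<sigma> Plus x)
        - sqrt ((rtr (V_hat \<beta> ** (\<sigma> Plus False - \<sigma> Plus True)) / 2)\<^sup>2 + (K_plus (lam 0) \<sigma> x)\<^sup>2))" for x
      by (simp add: val opt_value_def rtr_sigma_z_eq[OF \<sigma>] rtr_V_hat_eq[OF \<sigma>] K_plus_eq[OF \<sigma>])
    assume "\<epsilon> = 0 \<or> sin (\<theta> / 2) = 0 \<or> 1 / 2 \<le> \<epsilon> * (cos (\<theta> / 2))\<^sup>2"
    from optimality[OF \<epsilon> this \<sigma>] obtain S
      where "\<And>a x. (\<Sum>l\<in>UNIV. D a x l *\<^sub>R S l) = \<sigma> a x"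
        and "\<And>l. dual_cone (S l - witness_value F \<sigma> *\<^sub>R mat 1)"
      unfolding val by blast
    from strong_duality[OF feasible cone this]
    show "primal_optimum \<sigma> (witness_value F \<sigma>)" "dual_optimal \<sigma> F"
      by auto
  qed
  then show ?thesis
    unfolding psi_def using critical_efficiency_limit eventually_violation ex_violation by blast
qed

end
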